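(* Let $\varphi_1,\varphi_2:\mathbb{R}^p\to\mathbb{R}\cup\{\infty\}$ and $\varphi=\varphi_1+\varphi_2$, and suppose that either the "smooth case" assumption or the "strongly convex case" assumption (both defined in the context) holds. Consider the iterates generated by Algorithm 1 (defined in the context) with tolerance $\varepsilon>0$. Then the following hold. (i) At every iteration the number of backtrackings (executions of step (8)) is finite, regardless of whether $i_{\max}$ is finite or not. (ii) The algorithm terminates in $K\le\frac{1}{c\gamma\varepsilon^2}\,\bigl|\varphi_\gamma^{\rm DR}(s^0)-\min\varphi\bigr|$ iterations. (iii) The last iterate $(s^K,u^K,v^K)$ yields: - in the smooth case, a point $z:=v^K$ satisfying $\operatorname{dist}(0,\hat\partial\varphi(z))\le 2\varepsilon$; - in the strongly convex case, a triplet $(x,y,z):=(u^K,\gamma^{-1}(u^K-s^K),v^K)$ satisfying $-y\in\partial\varphi_1(x)$, $\operatorname{dist}(y,\partial\varphi_2(z))\le\varepsilon$ and $\|x-z\|\le\gamma\varepsilon$.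
   Context: Smooth case assumption: $\varphi_1:\mathbb{R}^p\to\mathbb{R}$ is differentiable with $L_{\varphi_1}$-Lipschitz continuous gradient; $\varphi_2:\mathbb{R}^p\to\mathbb{R}\cup\{\infty\}$ is lower semicontinuous (lsc); $\operatorname{argmin}\varphi\neq\emptyset$. Strongly convex case assumption: $\varphi_1:\mathbb{R}^p\to\mathbb{R}\cup\{\infty\}$ is proper, lsc and $\mu_{\varphi_1}$-strongly convex ($\varphi_1-\frac{\mu_{\varphi_1}}2\|\cdot\|^2$ is convex, $\mu_{\varphi_1}>0$); $\varphi_2:\mathbb{R}^p\to\mathbb{R}\cup\{\infty\}$ is proper, lsc and convex; $0\in\operatorname{relint}(\operatorname{dom}\varphi_1-\operatorname{dom}\varphi_2)$. Notation: $\hat\partial h$ is the regular (Fréchet) subdifferential, i.e. $v\in\hat\partial h(\bar x)$ iff $\liminf_{\bar x\ne x\to\bar x}\frac{h(x)-h(\bar x)-\langle v,x-\bar x\rangle}{\|x-\bar x\|}\ge0$; for convex functions $\partial$ is the usual convex subdifferential. $\operatorname{dist}(x,E)=\inf_{z\in E}\|z-x\|$. For $\gamma>0$, $\operatorname{prox}_{\gamma h}(x)=\operatorname{argmin}_w\{h(w)+\frac1{2\gamma}\|w-x\|^2\}$. The DRS oracle is $\mathrm{DRS}_\gamma(s)=\{(u,v): u\in\operatorname{prox}_{\gamma\varphi_1}(s),\ v\in\operatorname{prox}_{\gamma\varphi_2}(2u-s)\}$. The Douglas–Rachford envelope is $$\varphi_\gamma^{\rm DR}(s)=\varphi_1(u)+\varphi_2(v)+\tfrac1\gamma\langle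 s-u,v-u\rangle+\tfrac1{2\gamma}\|v-u\|^2,\quad (u,v)\in\mathrm{DRS}_\gamma(s),$$ whose value does not depend on the choice of $(u,v)$ under the standing stepsize restrictions below. Constant: $C(\alpha,\lambda)=\frac{\lambda}{(1+\alpha)^2}\bigl(\frac{2-\lambda}{2}-\alpha\,m\bigr)$, where $m=\max\{\alpha-\frac\lambda2,0\}$ if $\varphi_1$ is convex and $m=1$ otherwise. Algorithm 1 (linesearch DRS). Inputs: $s^0\in\mathbb{R}^p$, tolerance $\varepsilon$, relaxation $\lambda\in(0,2)$, maximum number of backtracks $i_{\max}\in\mathbb{N}\cup\{\infty\}$. In the smooth case set $\pi=1$, take $0<\gamma<1/L_{\varphi_1}$ if $\varphi_1$ is convex and $0<\gamma<\frac{2-\lambda}{2L_{\varphi_1}}$ otherwise, and $0<c<C(\gamma L_{\varphi_1},\lambda)$. In the strongly convex case set $\pi=-1$, take $\gamma>1/\mu_{\varphi_1}$ and $0<c<C(1/(\gamma\mu_{\varphi_1}),\lambda)$. Initialize $k=0$ and $(u^0,v^0)\in\mathrm{DRS}_\gamma(s^0)$. (1) $r^k=u^k-v^k$; if $\frac1\gamma\|r^k\|\le\varepsilon$, stop and return $(s^k,u^k,v^k)$. (2) $\bar s^{k+1}=s^k-\lambda r^k$. (3) Select an arbitrary direction $d^k\in\mathbb{R}^p$; set $\tau_k=1$, $i_k=0$. (4) $s^{k+1}=(1-\tau_k)\bar s^{k+1}+\tau_k(s^k+d^k)$. (5) Compute $(u^{k+1},v^{k+1})\in\mathrm{DRS}_\gamma(s^{k+1})$.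 (6) If $\pi\varphi_\gamma^{\rm DR}(s^{k+1})\le\pi\varphi_\gamma^{\rm DR}(s^k)-\frac c\gamma\|r^k\|^2$: $k\leftarrow k+1$ and go to (1). (7) Otherwise, if $i_k=i_{\max}$: set $s^{k+1}=\bar s^{k+1}$, $(u^{k+1},v^{k+1})\in\mathrm{DRS}_\gamma(s^{k+1})$, $k\leftarrow k+1$ and go to (1). (8) Otherwise (backtrack): $\tau_k\leftarrow\tau_k/2$, $i_k\leftarrow i_k+1$ and go to (4). *)

theory Defs
  imports "HOL-Analysis.Analysis"
begin

section \<open>Extended-real-valued functions\<close>

text \<open>
  Functions into \<open>\<real> \<union> {\<infinity>}\<close> are \<open>ereal\<close>-valued functions that avoid \<open>-\<infinity>\<close>.
\<close>

definition edom :: "('a \<Rightarrow> ereal) \<Rightarrow> 'a set" where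
  "edom f = {x. f x < \<infinity>}"

definition proper :: "('a \<Rightarrow> ereal) \<Rightarrow> bool" where
  "proper f \<longleftrightarrow> (\<forall>x. f x \<noteq> -\<infinity>) \<and> (\<exists>x. f x \<noteq> \<infinity>)"

definition lsc :: "('a::topological_space \<Rightarrow> ereal) \<Rightarrow> bool" where
  "lsc f \<longleftrightarrow> (\<forall>x. f x \<le> Liminf (at x) f)"

text \<open>Since \<open>0 * \<infinity> = 0\<close> in \<open>ereal\<close>, the inequality is harmless at \<open>t = 0\<close> and \<open>t = 1\<close>.\<close>

definition econvex :: "('a::real_vector \<Rightarrow> ereal) \<Rightarrow> bool" where
  "econvex f \<longleftrightarrow> (\<forall>x y t. 0 \<le> t \<and> t \<le> 1 \<longrightarrow>
     f ((1 - t) *\<^sub>R x + t *\<^sub>R y) \<le> ereal (1 - t) * f x + ereal t * f y)"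

definition strongly_econvex :: "real \<Rightarrow> ('a::real_normed_vector \<Rightarrow> ereal) \<Rightarrow> bool" where
  "strongly_econvex \<mu> f \<longleftrightarrow> \<mu> > 0 \<and> econvex (\<lambda>x. f x - ereal (\<mu> / 2 * (norm x)\<^sup>2))"

text \<open>
  As is usual in variational analysis, the set of minimizers of the function that is
  constantly \<open>\<infinity>\<close> is empty.
\<close>

definition argmin :: "('a \<Rightarrow> ereal) \<Rightarrow> 'a set" where
  "argmin f = {x. f x < \<infinity> \<and> (\<forall>y. f x \<le> f y)}"

definition regular_subdiff :: "('a::real_inner \<Rightarrow> ereal) \<Rightarrow> 'a \<Rightarrow> 'a set" where
  "regular_subdiff h x = {v. \<bar>h x\<bar> \<noteq> \<infinity> \<and>
     0 \<le> Liminf (at x) (\<lambda>y. (h y - h x - ereal (v \<bullet> (y - x))) / ereal (norm (y - x)))}"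

definition convex_subdiff :: "('a::real_inner \<Rightarrow> ereal) \<Rightarrow> 'a \<Rightarrow> 'a set" where
  "convex_subdiff h x = {v. \<bar>h x\<bar> \<noteq> \<infinity> \<and> (\<forall>y. h x + ereal (v \<bullet> (y - x)) \<le> h y)}"

text \<open>
  Unlike \<^const>\<open>infdist\<close>, the distance to the empty set is \<open>\<infinity>\<close>, so that an upper bound on it
  entails that the set is nonempty.
\<close>

definition edist_set :: "'a::real_normed_vector \<Rightarrow> 'a set \<Rightarrow> ereal" where
  "edist_set x E = (INF z\<in>E. ereal (norm (z - x)))"


section \<open>Douglas--Rachford oracle and envelope\<close>

definition prox :: "real \<Rightarrow> ('a::real_inner \<Rightarrow> ereal) \<Rightarrow> 'a \<Rightarrow> 'a set" where
  "prox \<gamma> h x = argmin (\<lambda>w. h w + ereal (1 / (2 * \<gamma>) * (norm (w - x))\<^sup>2))"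

definition DRS ::
  "('a::real_inner \<Rightarrow> ereal) \<Rightarrow> ('a \<Rightarrow> ereal) \<Rightarrow> real \<Rightarrow> 'a \<Rightarrow> ('a \<times> 'a) set" where
  "DRS \<phi>1 \<phi>2 \<gamma> s = {(u, v). u \<in> prox \<gamma> \<phi>1 s \<and> v \<in> prox \<gamma> \<phi>2 (2 *\<^sub>R u - s)}"

text \<open>
  The envelope is the common value of the expression below over all oracle outputs
  \<open>(u, v)\<close>; under the stepsize restrictions that value is unique.
\<close>

definition DRE ::
  "('a::real_inner \<Rightarrow> ereal) \<Rightarrow> ('a \<Rightarrow> ereal) \<Rightarrow> real \<Rightarrow> 'a \<Rightarrow> ereal" where
  "DRE \<phi>1 \<phi>2 \<gamma> s = (THE e. \<exists>(u, v) \<in> DRS \<phi>1 \<phi>2 \<gamma> s.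
     e = \<phi>1 u + \<phi>2 v
         + ereal (1 / \<gamma> * ((s - u) \<bullet> (v - u)) + 1 / (2 * \<gamma>) * (norm (v - u))\<^sup>2))"


section \<open>Standing assumptions and parameters\<close>

definition smooth_assumption ::
  "real \<Rightarrow> ('a::real_inner \<Rightarrow> ereal) \<Rightarrow> ('a \<Rightarrow> ereal) \<Rightarrow> bool" where
  "smooth_assumption L \<phi>1 \<phi>2 \<longleftrightarrow>
     (\<exists>f G. \<phi>1 = (\<lambda>x. ereal (f x)) \<and> (\<forall>x. GDERIV f x :> G x) \<and> L-lipschitz_on UNIV G)
     \<and> (\<forall>x. \<phi>2 x \<noteq> -\<infinity>) \<and> lsc \<phi>2
     \<and> argmin (\<lambda>x. \<phi>1 x + \<phi>2 x) \<noteq> {}"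

definition strongly_convex_assumption ::
  "real \<Rightarrow> ('a::euclidean_space \<Rightarrow> ereal) \<Rightarrow> ('a \<Rightarrow> ereal) \<Rightarrow> bool" where
  "strongly_convex_assumption \<mu> \<phi>1 \<phi>2 \<longleftrightarrow>
     proper \<phi>1 \<and> lsc \<phi>1 \<and> strongly_econvex \<mu> \<phi>1
     \<and> proper \<phi>2 \<and> lsc \<phi>2 \<and> econvex \<phi>2
     \<and> 0 \<in> rel_interior {x - y | x y. x \<in> edom \<phi>1 \<and> y \<in> edom \<phi>2}"

text \<open>The case that is treated, with the Lipschitz modulus of the gradient of \<open>\<phi>\<^sub>1\<close>
  respectively the strong convexity modulus of \<open>\<phi>\<^sub>1\<close>.\<close>

datatype dr_case = Smooth real | Strongly_Convex real

fun dr_assumption ::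
  "dr_case \<Rightarrow> ('a::euclidean_space \<Rightarrow> ereal) \<Rightarrow> ('a \<Rightarrow> ereal) \<Rightarrow> bool" where
  "dr_assumption (Smooth L) \<phi>1 \<phi>2 \<longleftrightarrow> smooth_assumption L \<phi>1 \<phi>2"
| "dr_assumption (Strongly_Convex \<mu>) \<phi>1 \<phi>2 \<longleftrightarrow> strongly_convex_assumption \<mu> \<phi>1 \<phi>2"

fun dr_sign :: "dr_case \<Rightarrow> real" where
  "dr_sign (Smooth L) = 1"
| "dr_sign (Strongly_Convex \<mu>) = -1"

definition dr_const :: "('a::real_vector \<Rightarrow> ereal) \<Rightarrow> real \<Rightarrow> real \<Rightarrow> real" where
  "dr_const \<phi>1 \<alpha> lam =
     lam / (1 + \<alpha>)\<^sup>2 * ((2 - lam) / 2 - \<alpha> * (if econvex \<phi>1 then max (\<alpha> - lam / 2) 0 else 1))"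

text \<open>
  The upper bounds \<open>\<gamma> < 1 / L\<close> and \<open>\<gamma> < (2 - lam) / (2 * L)\<close> are written without division:
  for \<open>L = 0\<close> they are void in the mathematics (\<open>1 / 0 = \<infinity>\<close>), whereas \<open>1 / 0 = 0\<close> in HOL.
\<close>

fun dr_params :: "dr_case \<Rightarrow> ('a::real_vector \<Rightarrow> ereal) \<Rightarrow> real \<Rightarrow> real \<Rightarrow> real \<Rightarrow> bool" where
  "dr_params (Smooth L) \<phi>1 \<gamma> lam c \<longleftrightarrow>
     0 < \<gamma> \<and> (if econvex \<phi>1 then \<gamma> * L < 1 else \<gamma> * (2 * L) < 2 - lam)
     \<and> 0 < c \<and> c < dr_const \<phi>1 (\<gamma> * L) lam"
| "dr_params (Strongly_Convex \<mu>) \<phi>1 \<gamma> lam c \<longleftrightarrow>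
     1 / \<mu> < \<gamma> \<and> 0 < c \<and> c < dr_const \<phi>1 (1 / (\<gamma> * \<mu>)) lam"


section \<open>The linesearch algorithm\<close>

text \<open>
  The algorithm is a nondeterministic transition system: the direction and the elements of the
  set-valued oracle are chosen arbitrarily.
  \<^item> \<open>Outer k s u v\<close>: start of iteration \<open>k\<close> with \<open>(s\<^sup>k, u\<^sup>k, v\<^sup>k) = (s, u, v)\<close>, before the
    stopping test.
  \<^item> \<open>Trial k s u v d \<tau> i\<close>: in iteration \<open>k\<close>, the trial point for direction \<open>d\<close> and stepsize
    \<open>\<tau>\<close> is about to be formed, after \<open>i\<close> backtrackings.
  \<^item> \<open>Returned k s u v\<close>: the stopping test succeeded with iteration counter \<open>k\<close>, and
    \<open>(s, u, v)\<close> is returned.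
\<close>

datatype 'a config =
    Outer nat 'a 'a 'a
  | Trial nat 'a 'a 'a 'a real nat
  | Returned nat 'a 'a 'a

definition nominal_point :: "real \<Rightarrow> 'a::real_vector \<Rightarrow> 'a \<Rightarrow> 'a \<Rightarrow> 'a" where
  "nominal_point lam s u v = s - lam *\<^sub>R (u - v)"

definition trial_point :: "real \<Rightarrow> 'a::real_vector \<Rightarrow> 'a \<Rightarrow> 'a \<Rightarrow> 'a \<Rightarrow> real \<Rightarrow> 'a" where
  "trial_point lam s u v d \<tau> = (1 - \<tau>) *\<^sub>R nominal_point lam s u v + \<tau> *\<^sub>R (s + d)"

definition sufficient_decrease ::
  "('a::real_inner \<Rightarrow> ereal) \<Rightarrow> ('a \<Rightarrow> ereal) \<Rightarrow> real \<Rightarrow> real \<Rightarrow> real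
   \<Rightarrow> 'a \<Rightarrow> 'a \<Rightarrow> 'a \<Rightarrow> 'a \<Rightarrow> bool" where
  "sufficient_decrease \<phi>1 \<phi>2 \<pi> \<gamma> c s u v s' \<longleftrightarrow>
     ereal \<pi> * DRE \<phi>1 \<phi>2 \<gamma> s'
       \<le> ereal \<pi> * DRE \<phi>1 \<phi>2 \<gamma> s - ereal (c / \<gamma> * (norm (u - v))\<^sup>2)"

inductive dr_step ::
  "('a::real_inner \<Rightarrow> ereal) \<Rightarrow> ('a \<Rightarrow> ereal) \<Rightarrow> real \<Rightarrow> real \<Rightarrow> real \<Rightarrow> real \<Rightarrow> real \<Rightarrow> enat
   \<Rightarrow> 'a config \<Rightarrow> 'a config \<Rightarrow> bool"
  for \<phi>1 \<phi>2 \<pi> \<gamma> lam c \<epsilon> imax where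
  stop:
    "1 / \<gamma> * norm (u - v) \<le> \<epsilon>
     \<Longrightarrow> dr_step \<phi>1 \<phi>2 \<pi> \<gamma> lam c \<epsilon> imax (Outer k s u v) (Returned k s u v)"
| direction:
    "\<not> 1 / \<gamma> * norm (u - v) \<le> \<epsilon>
     \<Longrightarrow> dr_step \<phi>1 \<phi>2 \<pi> \<gamma> lam c \<epsilon> imax (Outer k s u v) (Trial k s u v d 1 0)"
| accept:
    "s' = trial_point lam s u v d \<tau> \<Longrightarrow> (u', v') \<in> DRS \<phi>1 \<phi>2 \<gamma> s'
     \<Longrightarrow> sufficient_decrease \<phi>1 \<phi>2 \<pi> \<gamma> c s u v s'
     \<Longrightarrow> dr_step \<phi>1 \<phi>2 \<pi> \<gamma> lam c \<epsilon> imax (Trial k s u v d \<tau> i) (Outer (Suc k) s' u' v')"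
| nominal:
    "s' = trial_point lam s u v d \<tau> \<Longrightarrow> (u', v') \<in> DRS \<phi>1 \<phi>2 \<gamma> s'
     \<Longrightarrow> \<not> sufficient_decrease \<phi>1 \<phi>2 \<pi> \<gamma> c s u v s'
     \<Longrightarrow> enat i = imax
     \<Longrightarrow> s'' = nominal_point lam s u v \<Longrightarrow> (u'', v'') \<in> DRS \<phi>1 \<phi>2 \<gamma> s''
     \<Longrightarrow> dr_step \<phi>1 \<phi>2 \<pi> \<gamma> lam c \<epsilon> imax (Trial k s u v d \<tau> i) (Outer (Suc k) s'' u'' v'')"
| backtrack:
    "s' = trial_point lam s u v d \<tau> \<Longrightarrow> (u', v') \<in> DRS \<phi>1 \<phi>2 \<gamma> s'
     \<Longrightarrow> \<not> sufficient_decrease \<phi>1 \<phi>2 \<pi> \<gamma> c s u v s'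
     \<Longrightarrow> enat i \<noteq> imax
     \<Longrightarrow> dr_step \<phi>1 \<phi>2 \<pi> \<gamma> lam c \<epsilon> imax (Trial k s u v d \<tau> i) (Trial k s u v d (\<tau> / 2) (Suc i))"

text \<open>
  A maximal execution from \<open>s0\<close>: \<open>\<sigma>\<close> lists the configurations and \<open>N\<close> is the number of
  transitions, possibly \<open>\<infinity>\<close>. A finite execution ends only where no transition is possible, which
  a priori includes being stuck because the oracle returns no point.
\<close>

definition execution ::
  "('a::real_inner \<Rightarrow> ereal) \<Rightarrow> ('a \<Rightarrow> ereal) \<Rightarrow> real \<Rightarrow> real \<Rightarrow> real \<Rightarrow> real \<Rightarrow> real \<Rightarrow> enat
   \<Rightarrow> 'a \<Rightarrow> (nat \<Rightarrow> 'a config) \<Rightarrow> enat \<Rightarrow> bool" where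
  "execution \<phi>1 \<phi>2 \<pi> \<gamma> lam c \<epsilon> imax s0 \<sigma> N \<longleftrightarrow>
     (\<exists>(u0, v0) \<in> DRS \<phi>1 \<phi>2 \<gamma> s0. \<sigma> 0 = Outer 0 s0 u0 v0)
     \<and> (\<forall>n. enat n < N \<longrightarrow> dr_step \<phi>1 \<phi>2 \<pi> \<gamma> lam c \<epsilon> imax (\<sigma> n) (\<sigma> (Suc n)))
     \<and> (\<forall>M. N = enat M \<longrightarrow> (\<nexists>x. dr_step \<phi>1 \<phi>2 \<pi> \<gamma> lam c \<epsilon> imax (\<sigma> M) x))"

text \<open>The transitions of an execution that are backtrackings of iteration \<open>k\<close>; no other
  transition leads from a \<open>Trial\<close> to a \<open>Trial\<close> configuration.\<close>

definition backtracks :: "(nat \<Rightarrow> 'a config) \<Rightarrow> enat \<Rightarrow> nat \<Rightarrow> nat set" where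
  "backtracks \<sigma> N k = {n. enat n < N \<and>
     (\<exists>s u v d \<tau> i s' u' v' d' \<tau>' i'.
        \<sigma> n = Trial k s u v d \<tau> i \<and> \<sigma> (Suc n) = Trial k s' u' v' d' \<tau>' i')}"

end

theory Submission
  imports Defs
begin

text \<open>
  Everything rests on one fact: in both cases a signed Douglas--Rachford envelope
  \<open>\<pi> \<cdot> \<phi>\<^sup>D\<^sup>R\<close> is real-valued, bounded below, and satisfies the acceptance test of the
  linesearch on a whole neighbourhood of the nominal point \<open>s - \<lambda> (u - v)\<close> whenever \<open>u \<noteq> v\<close>.
  Trial points converge to the nominal point, so each iteration backtracks finitely often;
  every iteration that does not stop lowers \<open>\<pi> \<cdot> \<phi>\<^sup>D\<^sup>R\<close> by at least
  \<open>(c / \<gamma>) (\<gamma> \<epsilon>)\<^sup>2 = c \<gamma> \<epsilon>\<^sup>2\<close>, so boundedness caps their number. This part is the locale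
  \<open>dr_linesearch\<close>, whose outcome is \<open>execution_terminates\<close>.

  For the decrease near the nominal point, compare the envelope at \<open>s\<close>, with oracle output
  \<open>(u, v)\<close>, and at an arbitrary \<open>s'\<close> with \<open>u' \<in> prox \<gamma> \<phi>\<^sub>1 s'\<close>. Put \<open>w = v - u\<close>,
  \<open>d = u' - u\<close> and \<open>h = (s' - u') - (s - u)\<close>, so that \<open>h / \<gamma>\<close> is the change of the
  (sub)gradient of \<open>\<phi>\<^sub>1\<close>.
  \<^item> In the smooth case, testing the minimization that defines the envelope at \<open>s'\<close> with the old
    point \<open>v\<close> gives
    \<open>\<gamma> (\<phi>\<^sup>D\<^sup>R s' - \<phi>\<^sup>D\<^sup>R s) \<le> \<gamma> (\<phi>\<^sub>1 u' - \<phi>\<^sub>1 u - \<langle>\<nabla>\<phi>\<^sub>1 u', d\<rangle>) + \<parallel>d\<parallel>\<^sup>2 / 2 + \<langle>w, h - d\<rangle>\<close>.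
    The bracket is at most \<open>\<alpha> \<parallel>d\<parallel>\<^sup>2 / 2\<close> by the descent lemma, and at most
    \<open>- \<parallel>h\<parallel>\<^sup>2 / (2 \<alpha>)\<close> by cocoercivity if \<open>\<phi>\<^sub>1\<close> is convex, where \<open>\<alpha> = \<gamma> L\<close>.
  \<^item> In the strongly convex case, the subgradient inequalities at \<open>u\<close> and \<open>v\<close> give
    \<open>\<gamma> (\<phi>\<^sup>D\<^sup>R s' - \<phi>\<^sup>D\<^sup>R s) \<ge> \<parallel>d\<parallel>\<^sup>2 / (2 \<alpha>) + \<langle>w, h - d\<rangle> - \<parallel>h\<parallel>\<^sup>2 / 2\<close>, where
    \<open>\<alpha> = 1 / (\<gamma> \<mu>)\<close>. This is the convex smooth bound with \<open>d\<close> and \<open>h\<close> exchanged and the sign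
    reversed, which is how Fenchel duality between the two cases shows up.

  At the nominal point \<open>d + h = \<lambda> w\<close>, hence \<open>\<langle>w, h - d\<rangle> = (\<parallel>h\<parallel>\<^sup>2 - \<parallel>d\<parallel>\<^sup>2) / \<lambda>\<close>. With
  \<open>\<parallel>h\<parallel> \<le> \<alpha> \<parallel>d\<parallel>\<close> (respectively \<open>\<parallel>d\<parallel> \<le> \<alpha> \<parallel>h\<parallel>\<close>) the bounds become \<open>- C \<parallel>w\<parallel>\<^sup>2\<close>, where \<open>C\<close> is
  the constant \<open>dr_const\<close>. The bounds are continuous in \<open>s'\<close>, because \<open>u\<close> is a Lipschitz function
  of \<open>s\<close>; since \<open>c < C\<close>, the test holds near the nominal point.

  The envelope is at least \<open>min \<phi>\<close> in the smooth case (\<open>min_le_E\<close>) and at most \<open>min \<phi>\<close> in the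
  strongly convex one (\<open>E_le_objective\<close>). The optimality conditions of the final two proximal
  steps (\<open>residual_subgradient\<close>, \<open>prox_inclusions\<close>) turn the stopping test into the claimed
  approximate stationarity.
\<close>

section \<open>Lower semicontinuous functions and attainment of minima\<close>

lemma lsc_eventually_greater:
  assumes "lsc F" "c < F x"
  shows "\<forall>\<^sub>F y in nhds x. c < F y"
proof -
  have "c < Liminf (at x) F" using assms unfolding lsc_def by (meson less_le_trans)
  then have "\<forall>\<^sub>F y in at x. c < F y" by (rule less_LiminfD)
  with assms(2) show ?thesis by (auto simp: eventually_at_filter elim: eventually_mono)
qed

lemma lscI:
  assumes "\<And>x c. c < F x \<Longrightarrow> \<forall>\<^sub>F y in nhds x. c < F y"
  shows "lsc F"
  unfolding lsc_def
proof
  fix x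
  show "F x \<le> Liminf (at x) F"
    unfolding le_Liminf_iff eventually_at_filter using assms by (auto intro: eventually_mono)
qed

lemma lsc_sublevel_closed:
  assumes "lsc F"
  shows "closed {x. F x \<le> c}"
proof -
  have "open {x. c < F x}"
  proof (subst open_subopen, clarify)
    fix x assume "c < F x"
    from lsc_eventually_greater[OF assms this]
    show "\<exists>T. open T \<and> x \<in> T \<and> T \<subseteq> {x. c < F x}" by (auto simp: eventually_nhds)
  qed
  moreover have "{x. F x \<le> c} = - {x. c < F x}" by auto
  ultimately show ?thesis by (simp add: closed_def)
qed

text \<open>
  Any \<open>c < F x + G x\<close> splits into real levels \<open>a < F x\<close> and \<open>b < G x\<close> with \<open>c \<le> a + b\<close>, and each
  level persists nearby. Excluding \<open>-\<infinity>\<close> is what makes the splitting possible.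
\<close>

lemma lsc_add:
  assumes "lsc F" "lsc G" "\<And>x. F x \<noteq> -\<infinity>" "\<And>x. G x \<noteq> -\<infinity>"
  shows "lsc (\<lambda>x. F x + G x)"
proof (rule lscI)
  fix x c assume c: "c < F x + G x"
  have "\<exists>a b. a < F x \<and> b < G x \<and> c \<le> ereal (a + b)"
  proof (cases c)
    case MInf
    have "-\<infinity> < F x" "-\<infinity> < G x" using assms(3,4)[of x] by (simp_all add: less_le)
    then obtain a b where "ereal a < F x" "ereal b < G x" using ereal_dense2 by blast
    then show ?thesis using MInf by auto
  next
    case PInf
    then show ?thesis using c by simp
  next
    case (real r)
    show ?thesis
    proof (cases "F x")
      case (real f)
      then have "ereal (r - f) < G x" using c \<open>c = ereal r\<close> by (cases "G x") auto
      then obtain b where b: "ereal (r - f) < ereal b" "ereal b < G x"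
        using ereal_dense2 by blast
      then show ?thesis using real \<open>c = ereal r\<close>
        by (intro exI[of _ "r - b"] exI[of _ b]) auto
    next
      case PInf
      have "-\<infinity> < G x" using assms(4)[of x] by (simp add: less_le)
      then obtain b where "ereal b < G x" using ereal_dense2 by blast
      then show ?thesis using PInf \<open>c = ereal r\<close>
        by (intro exI[of _ "r - b"] exI[of _ b]) auto
    qed (use assms(3) in auto)
  qed
  then obtain a b where "ereal a < F x" "ereal b < G x" and c: "c \<le> ereal (a + b)" by auto
  then have "\<forall>\<^sub>F y in nhds x. ereal a < F y" "\<forall>\<^sub>F y in nhds x. ereal b < G y"
    using lsc_eventually_greater[OF assms(1)] lsc_eventually_greater[OF assms(2)] by simp_all
  then show "\<forall>\<^sub>F y in nhds x. c < F y + G y"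
  proof eventually_elim
    case (elim y)
    then have "ereal a + ereal b < F y + G y" by (rule ereal_add_strict_mono2)
    then show ?case using c by (simp add: order_le_less_trans)
  qed
qed

lemma lsc_ereal_continuous:
  fixes q :: "'a::topological_space \<Rightarrow> real"
  assumes "continuous_on UNIV q"
  shows "lsc (\<lambda>x. ereal (q x))"
proof (rule lscI)
  fix x c assume c: "c < ereal (q x)"
  have "((\<lambda>x. ereal (q x)) \<longlongrightarrow> ereal (q x)) (nhds x)"
    using assms by (auto simp: tendsto_nhds_iff continuous_on_def)
  then show "\<forall>\<^sub>F y in nhds x. c < ereal (q y)" using c by (rule order_tendstoD)
qed

text \<open>
  The sublevel set of \<open>x0\<close> is compact, so a minimizing sequence in it has a limit point, which lies
  in every closed sublevel set above the infimum.
\<close>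

lemma lsc_bounded_sublevel_attains_min:
  fixes F :: "'a::heine_borel \<Rightarrow> ereal"
  assumes "lsc F" "F x0 < \<infinity>" "bounded {x. F x \<le> F x0}"
  shows "argmin F \<noteq> {}"
proof -
  define S where "S = {x. F x \<le> F x0}"
  have "F ` S \<noteq> {}" by (auto simp: S_def)
  then obtain y where y: "\<And>n. y n \<in> F ` S" and ylim: "y \<longlonglongrightarrow> Inf (F ` S)"
    using Inf_as_limit by metis
  then obtain x where x: "\<And>n. x n \<in> S" "\<And>n. y n = F (x n)"
    unfolding image_iff by metis
  have "compact S"
    using assms lsc_sublevel_closed[OF assms(1)] by (simp add: S_def compact_eq_bounded_closed)
  then obtain l r where l: "l \<in> S" and r: "strict_mono r" and xl: "(x \<circ> r) \<longlonglongrightarrow> l"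
    using x(1) unfolding compact_def by metis
  have low: "F l \<le> Inf (F ` S)"
  proof (rule dense_ge)
    fix b assume "Inf (F ` S) < b"
    moreover have "(y \<circ> r) \<longlonglongrightarrow> Inf (F ` S)" using ylim r by (rule LIMSEQ_subseq_LIMSEQ)
    ultimately have "\<forall>\<^sub>F n in sequentially. (y \<circ> r) n < b" by (rule order_tendstoD(2)[rotated])
    then have "\<forall>\<^sub>F n in sequentially. (x \<circ> r) n \<in> {x. F x \<le> b}"
      by eventually_elim (simp add: x(2))
    then have "l \<in> {x. F x \<le> b}"
      using Lim_in_closed_set[OF lsc_sublevel_closed[OF assms(1)] _ _ xl] by simp
    then show "F l \<le> b" by simp
  qed
  have "F l \<le> F z" for z
  proof (cases "z \<in> S")
    case True
    then show ?thesis using low by (meson INF_lower order_trans)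
  next
    case False
    then show ?thesis using l by (auto simp: S_def)
  qed
  then have "l \<in> argmin F" using assms(2) l by (auto simp: argmin_def S_def intro: le_less_trans)
  then show ?thesis by blast
qed

text \<open>
  Quadratic growth beats the linear term outside a ball, which bounds the sublevel sets.
\<close>

lemma lsc_quadratic_growth_attains_min:
  fixes F :: "'a::euclidean_space \<Rightarrow> ereal"
  assumes "lsc F" "F x0 < \<infinity>" "0 < \<kappa>"
    and growth: "\<And>w. ereal (a + b \<bullet> (w - z) + \<kappa> / 2 * (norm (w - z))^2) \<le> F w"
  shows "argmin F \<noteq> {}"
proof (rule lsc_bounded_sublevel_attains_min[OF assms(1,2)])
  obtain C where C: "F x0 = ereal C"
    using assms(2) growth[of x0] by (cases "F x0") auto
  define R where "R = 1 + 2 * (\<bar>C - a\<bar> + norm b) / \<kappa>"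
  have "norm (w - z) \<le> R" if "F w \<le> F x0" for w
  proof (rule ccontr)
    assume "\<not> norm (w - z) \<le> R"
    moreover define t where "t = norm (w - z)"
    ultimately have t: "R < t" by simp
    have "1 \<le> R" using \<open>0 < \<kappa>\<close> by (simp add: R_def)
    then have t1: "1 < t" using t by simp
    have "ereal (a + b \<bullet> (w - z) + \<kappa> / 2 * t^2) \<le> ereal C"
      using growth[of w] that C t_def by (metis order_trans)
    then have "\<kappa> / 2 * t^2 \<le> (C - a) - b \<bullet> (w - z)" by simp
    also have "\<dots> \<le> \<bar>C - a\<bar> + norm b * t"
      using Cauchy_Schwarz_ineq2[of b "w - z"] by (simp add: t_def)
    also have "\<dots> \<le> (\<bar>C - a\<bar> + norm b) * t"
      using t1 mult_left_mono[of 1 t "\<bar>C - a\<bar>"] by (simp add: distrib_right)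
    finally have "\<kappa> / 2 * t \<le> \<bar>C - a\<bar> + norm b"
      using t1 by (simp add: power2_eq_square)
    then have "t \<le> 2 * (\<bar>C - a\<bar> + norm b) / \<kappa>" using \<open>0 < \<kappa>\<close> by (simp add: field_simps)
    then show False using t by (simp add: R_def)
  qed
  then have "{x. F x \<le> F x0} \<subseteq> cball z R" by (auto simp: dist_norm norm_minus_commute)
  then show "bounded {x. F x \<le> F x0}" using bounded_cball bounded_subset by blast
qed

section \<open>Proximal points\<close>

lemma quadratic_recentre:
  fixes w :: "'a::real_inner"
  shows "(norm (w - x))^2 = (norm (w - z))^2 + 2 * ((w - z) \<bullet> (z - x)) + (norm (z - x))^2"
  by (simp add: power2_norm_eq_inner inner_diff_left inner_diff_right inner_commute)

lemma prox_finite: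
  assumes "u \<in> prox \<gamma> h s" "\<And>x. h x \<noteq> -\<infinity>"
  obtains a where "h u = ereal a"
  using assms(1) assms(2)[of u] by (cases "h u") (auto simp: prox_def argmin_def)

lemma prox_minimal:
  assumes "u \<in> prox \<gamma> h s" "h u = ereal a" "h w \<le> ereal b"
  shows "a + 1 / (2 * \<gamma>) * (norm (u - s))^2 \<le> b + 1 / (2 * \<gamma>) * (norm (w - s))^2"
proof -
  have "h u + ereal (1 / (2 * \<gamma>) * (norm (u - s))^2)
      \<le> h w + ereal (1 / (2 * \<gamma>) * (norm (w - s))^2)"
    using assms(1) by (auto simp: prox_def argmin_def)
  also have "\<dots> \<le> ereal b + ereal (1 / (2 * \<gamma>) * (norm (w - s))^2)"
    using assms(3) by (rule add_right_mono)
  finally show ?thesis by (simp add: assms(2))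
qed

text \<open>
  The proximal term has curvature \<open>1 / \<gamma>\<close>, which exceeds the negative curvature \<open>\<rho>\<close> of the
  minorant. The case \<open>\<rho> = 0\<close> covers affine minorants of convex functions.
\<close>

lemma prox_nonempty:
  fixes h :: "'a::euclidean_space \<Rightarrow> ereal"
  assumes "lsc h" "\<And>x. h x \<noteq> -\<infinity>" "h x0 < \<infinity>" "0 < \<gamma>" "\<gamma> * \<rho> < 1"
    and minorant: "\<And>w. ereal (a + b \<bullet> (w - z) - \<rho> / 2 * (norm (w - z))^2) \<le> h w"
  shows "prox \<gamma> h x \<noteq> {}"
  unfolding prox_def
proof (rule lsc_quadratic_growth_attains_min)
  show "lsc (\<lambda>w. h w + ereal (1 / (2 * \<gamma>) * (norm (w - x))^2))"
    using assms(1,2) by (intro lsc_add lsc_ereal_continuous continuous_intros) auto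
  show "h x0 + ereal (1 / (2 * \<gamma>) * (norm (x0 - x))^2) < \<infinity>"
    using assms(2)[of x0] assms(3) by (cases "h x0") auto
  show "0 < 1 / \<gamma> - \<rho>" using assms(4,5) by (simp add: field_simps)
  fix w
  let ?q = "1 / (2 * \<gamma>) * (norm (w - x))^2"
  have "ereal (a + b \<bullet> (w - z) - \<rho> / 2 * (norm (w - z))^2) + ereal ?q \<le> h w + ereal ?q"
    using minorant by (rule add_right_mono)
  then have le: "ereal (a + b \<bullet> (w - z) - \<rho> / 2 * (norm (w - z))^2 + ?q) \<le> h w + ereal ?q"
    by (simp only: plus_ereal.simps)
  have split: "(b + (1 / \<gamma>) *\<^sub>R (z - x)) \<bullet> (w - z)
      = b \<bullet> (w - z) + (1 / \<gamma>) * ((w - z) \<bullet> (z - x))"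
    by (simp add: inner_add_left inner_add_right inner_commute)
  have eq: "a + b \<bullet> (w - z) - \<rho> / 2 * (norm (w - z))^2 + ?q
    = (a + 1 / (2 * \<gamma>) * (norm (z - x))^2) + (b + (1 / \<gamma>) *\<^sub>R (z - x)) \<bullet> (w - z)
      + (1 / \<gamma> - \<rho>) / 2 * (norm (w - z))^2"
    using assms(4) unfolding quadratic_recentre[of w x z] split by (simp add: field_simps)
  show "ereal ((a + 1 / (2 * \<gamma>) * (norm (z - x))^2) + (b + (1 / \<gamma>) *\<^sub>R (z - x)) \<bullet> (w - z)
      + (1 / \<gamma> - \<rho>) / 2 * (norm (w - z))^2) \<le> h w + ereal ?q"
    using le unfolding eq .
qed

text \<open>
  First-order optimality conditions are extracted from inequalities along a segment by dividing by
  \<open>t\<close> and letting \<open>t\<close> tend to \<open>0\<close>.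
\<close>

lemma nonpos_if_linear_le_quadratic:
  fixes a K :: real
  assumes "\<And>t. 0 < t \<Longrightarrow> t \<le> 1 \<Longrightarrow> t * a \<le> t^2 * K"
  shows "a \<le> 0"
proof (rule ccontr)
  assume "\<not> a \<le> 0"
  then have a: "0 < a" by simp
  (* the constants give t * K < a *)
  define t where "t = min 1 (a / (2 * (\<bar>K\<bar> + 1)))"
  have t: "0 < t" "t \<le> 1" using a by (auto simp: t_def)
  have "t * a \<le> t * (t * K)" using assms[OF t] by (simp add: power2_eq_square mult.assoc)
  then have "a \<le> t * K" using t by simp
  also have "\<dots> \<le> t * (\<bar>K\<bar> + 1)" using t by (intro mult_left_mono) auto
  also have "\<dots> \<le> a / (2 * (\<bar>K\<bar> + 1)) * (\<bar>K\<bar> + 1)"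
    by (intro mult_right_mono) (auto simp: t_def)
  also have "\<dots> = a / 2" by (simp add: field_simps add_nonneg_eq_0_iff)
  finally show False using a by simp
qed

text \<open>
  Proximal subgradients are regular: the error term divided by \<open>\<parallel>y - v\<parallel>\<close> is \<open>- K \<parallel>y - v\<parallel>\<close>, which
  tends to \<open>0\<close>.
\<close>

lemma regular_subdiff_of_quadratic_minorant:
  fixes h :: "'a::real_inner \<Rightarrow> ereal"
  assumes a: "h v = ereal a"
    and minorant: "\<And>y. ereal (a + q \<bullet> (y - v) - K * (norm (y - v))^2) \<le> h y"
  shows "q \<in> regular_subdiff h v"
proof -
  let ?r = "\<lambda>y. (h y - h v - ereal (q \<bullet> (y - v))) / ereal (norm (y - v))"
  have "0 \<le> Liminf (at v) ?r"
  proof (cases "at v = bot")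
    case False
    have "((\<lambda>y. - K * norm (y - v)) \<longlongrightarrow> - K * norm (v - v)) (at v)" by (intro tendsto_intros)
    then have "((\<lambda>y. ereal (- K * norm (y - v))) \<longlongrightarrow> 0) (at v)"
      by (simp add: zero_ereal_def)
    then have "0 = Liminf (at v) (\<lambda>y. ereal (- K * norm (y - v)))"
      using False by (simp add: lim_imp_Liminf)
    also have "\<dots> \<le> Liminf (at v) ?r"
    proof (rule Liminf_mono)
      have "ereal (- K * norm (y - v)) \<le> ?r y" if "y \<noteq> v" for y
      proof (cases "h y")
        case (real b)
        have "0 < norm (y - v)" using that by simp
        moreover have "- K * norm (y - v) * norm (y - v) \<le> b - a - q \<bullet> (y - v)"
          using minorant[of y] real by (simp add: power2_eq_square mult.assoc)
        ultimately show ?thesis using real a by (simp add: pos_le_divide_eq)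
      qed (use minorant[of y] a that in auto)
      then show "\<forall>\<^sub>F y in at v. ereal (- K * norm (y - v)) \<le> ?r y"
        by (simp add: eventually_at_filter)
    qed
    finally show ?thesis .
  qed simp
  then show ?thesis by (simp add: regular_subdiff_def a)
qed

section \<open>Functions with Lipschitz gradient\<close>

text \<open>
  Along the segment from \<open>x\<close> to \<open>y\<close>, the gap between the two sides has a nonpositive derivative by
  the Lipschitz bound on the gradient.
\<close>

lemma descent_lemma:
  fixes f :: "'a::real_inner \<Rightarrow> real"
  assumes grad: "\<And>x. GDERIV f x :> G x" and lip: "L-lipschitz_on UNIV G"
  shows "f y \<le> f x + G x \<bullet> (y - x) + L / 2 * (norm (y - x))^2"
proof -
  define d where "d = y - x"
  define \<psi> where "\<psi> t = f (x + t *\<^sub>R d) - t * (G x \<bullet> d) - L / 2 * t^2 * (norm d)^2" for t :: real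
  have "\<psi> 1 \<le> \<psi> 0"
  proof (rule DERIV_nonpos_imp_nonincreasing[of 0 1 \<psi>])
    fix t :: real assume t: "0 \<le> t" "t \<le> 1"
    have "((\<lambda>t. f (x + t *\<^sub>R d)) has_derivative (\<lambda>r. (r *\<^sub>R d) \<bullet> G (x + t *\<^sub>R d))) (at t)"
      using grad[of "x + t *\<^sub>R d"] unfolding gderiv_def
      by (rule has_derivative_compose[rotated]) (auto intro!: derivative_eq_intros)
    then have "((\<lambda>t. f (x + t *\<^sub>R d)) has_real_derivative (d \<bullet> G (x + t *\<^sub>R d))) (at t)"
      by (simp add: has_field_derivative_def mult.commute[of _ "d \<bullet> _"])
    then have der: "(\<psi> has_real_derivative
        (d \<bullet> G (x + t *\<^sub>R d) - G x \<bullet> d - L * t * (norm d)^2)) (at t)"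
      unfolding \<psi>_def by (auto intro!: derivative_eq_intros)
    have "d \<bullet> G (x + t *\<^sub>R d) - G x \<bullet> d = (G (x + t *\<^sub>R d) - G x) \<bullet> d"
      by (simp add: inner_diff_left inner_diff_right inner_commute)
    also have "\<dots> \<le> norm (G (x + t *\<^sub>R d) - G x) * norm d" by (rule norm_cauchy_schwarz)
    also have "\<dots> \<le> (L * norm (t *\<^sub>R d)) * norm d"
      using lipschitz_onD[OF lip, of "x + t *\<^sub>R d" x]
      by (intro mult_right_mono) (auto simp: dist_norm)
    also have "\<dots> = L * t * (norm d)^2" using t by (simp add: power2_eq_square)
    finally show "\<exists>z. (\<psi> has_real_derivative z) (at t) \<and> z \<le> 0" using der by auto
  qed simp
  then show ?thesis by (simp add: \<psi>_def d_def)
qed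

lemma descent_lemma_lower:
  fixes f :: "'a::real_inner \<Rightarrow> real"
  assumes grad: "\<And>x. GDERIV f x :> G x" and lip: "L-lipschitz_on UNIV G"
  shows "f x + G x \<bullet> (y - x) - L / 2 * (norm (y - x))^2 \<le> f y"
proof -
  have "GDERIV (\<lambda>x. - f x) x :> - G x" for x using grad by (rule GDERIV_minus)
  moreover have "L-lipschitz_on UNIV (\<lambda>x. - G x)"
    using lip by (simp add: lipschitz_on_minus)
  ultimately show ?thesis using descent_lemma[of "\<lambda>x. - f x" "\<lambda>x. - G x" L y x] by simp
qed

text \<open>
  Convexity bounds \<open>f\<close> from above along the segment and the descent lemma bounds it from below up to
  a quadratic error.
\<close>

lemma smooth_convex_tangent:
  fixes f :: "'a::real_inner \<Rightarrow> real"
  assumes grad: "\<And>x. GDERIV f x :> G x" and lip: "L-lipschitz_on UNIV G"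
    and conv: "econvex (\<lambda>x. ereal (f x))"
  shows "f x + G x \<bullet> (y - x) \<le> f y"
proof -
  have "f x + G x \<bullet> (y - x) - f y \<le> 0"
  proof (rule nonpos_if_linear_le_quadratic)
    fix t :: real assume t: "0 < t" "t \<le> 1"
    have eq: "(1 - t) *\<^sub>R x + t *\<^sub>R y - x = t *\<^sub>R (y - x)" by (simp add: algebra_simps)
    have "f x + t * (G x \<bullet> (y - x)) - L / 2 * (t^2 * (norm (y - x))^2)
        \<le> f ((1 - t) *\<^sub>R x + t *\<^sub>R y)"
      using descent_lemma_lower[OF grad lip, of x "(1 - t) *\<^sub>R x + t *\<^sub>R y"] unfolding eq
      by (simp add: power_mult_distrib)
    also have "\<dots> \<le> (1 - t) * f x + t * f y"
      using conv t unfolding econvex_def by force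
    finally show "t * (f x + G x \<bullet> (y - x) - f y) \<le> t^2 * (L / 2 * (norm (y - x))^2)"
      by (simp add: algebra_simps)
  qed
  then show ?thesis by simp
qed

text \<open>
  The tangent at \<open>y\<close> is compared with \<open>f\<close> at the gradient step \<open>z = x - (G x - G y) / L\<close>, which
  minimizes the quadratic upper bound around \<open>x\<close> minus that tangent. For \<open>L = 0\<close> the quotient is
  \<open>0\<close> in HOL and the claim is the tangent inequality.
\<close>

lemma smooth_convex_cocoercive:
  fixes f :: "'a::real_inner \<Rightarrow> real"
  assumes grad: "\<And>x. GDERIV f x :> G x" and lip: "L-lipschitz_on UNIV G"
    and conv: "econvex (\<lambda>x. ereal (f x))"
  shows "f y + G y \<bullet> (x - y) + (norm (G x - G y))^2 / (2 * L) \<le> f x"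
proof (cases "L = 0")
  case True
  then show ?thesis using smooth_convex_tangent[OF grad lip conv] by simp
next
  case False
  then have L: "0 < L" using lipschitz_on_nonneg[OF lip] by simp
  define e where "e = G x - G y"
  define z where "z = x - (1 / L) *\<^sub>R e"
  have "f y + G y \<bullet> (z - y) \<le> f z" by (rule smooth_convex_tangent[OF grad lip conv])
  also have "\<dots> \<le> f x + G x \<bullet> (z - x) + L / 2 * (norm (z - x))^2"
    by (rule descent_lemma[OF grad lip])
  finally have "f y + G y \<bullet> (x - y) + (1 / L) * (e \<bullet> e) - L / 2 * (norm (z - x))^2 \<le> f x"
    by (simp add: z_def e_def inner_diff_left inner_diff_right algebra_simps)
  moreover have "L / 2 * (norm (z - x))^2 = (1 / (2 * L)) * (e \<bullet> e)"
    using L by (simp add: z_def power_divide power2_norm_eq_inner[symmetric] power2_eq_square)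
  ultimately show ?thesis using L by (simp add: e_def power2_norm_eq_inner field_simps)
qed

text \<open>
  A step against the gradient \<open>e\<close> of the proximal objective would decrease it to first order
  unless \<open>e = 0\<close>.
\<close>

lemma prox_smooth_gradient:
  fixes f :: "'a::real_inner \<Rightarrow> real"
  assumes grad: "\<And>x. GDERIV f x :> G x" and lip: "L-lipschitz_on UNIV G"
    and u: "u \<in> prox \<gamma> (\<lambda>x. ereal (f x)) s" and "0 < \<gamma>"
  shows "s - u = \<gamma> *\<^sub>R G u"
proof -
  define e where "e = G u + (1 / \<gamma>) *\<^sub>R (u - s)"
  have "(norm e)^2 \<le> 0"
  proof (rule nonpos_if_linear_le_quadratic)
    fix t :: real assume t: "0 < t" "t \<le> 1"
    let ?w = "u - t *\<^sub>R e"
    have "f u + 1 / (2 * \<gamma>) * (norm (u - s))^2 \<le> f ?w + 1 / (2 * \<gamma>) * (norm (?w - s))^2"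
      by (rule prox_minimal[OF u refl]) simp
    moreover have "f ?w \<le> f u - t * (G u \<bullet> e) + t^2 * (L / 2 * (norm e)^2)"
      using descent_lemma[OF grad lip, of ?w u] by (simp add: power_mult_distrib mult.left_commute)
    moreover have "1 / (2 * \<gamma>) * (norm (?w - s))^2 = 1 / (2 * \<gamma>) * (norm (u - s))^2
        - t * (1 / \<gamma> * ((u - s) \<bullet> e)) + t^2 * (1 / (2 * \<gamma>) * (norm e)^2)"
      using \<open>0 < \<gamma>\<close> quadratic_recentre[of ?w s u]
      by (simp add: power_mult_distrib field_simps inner_commute)
    moreover have "(norm e)^2 = G u \<bullet> e + 1 / \<gamma> * ((u - s) \<bullet> e)"
      by (simp add: e_def power2_norm_eq_inner inner_add_left)
    ultimately show "t * (norm e)^2 \<le> t^2 * (L / 2 * (norm e)^2 + 1 / (2 * \<gamma>) * (norm e)^2)"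
      by (simp add: distrib_left)
  qed
  then have "e = 0" by simp
  then have "\<gamma> *\<^sub>R e = 0" by simp
  then show ?thesis using \<open>0 < \<gamma>\<close> by (simp add: e_def scaleR_add_right algebra_simps)
qed

section \<open>Convex functions\<close>

text \<open>
  With \<open>\<mu> = 0\<close> this is plain convexity, so that later statements serve both functions of the
  strongly convex case.
\<close>

lemma strongly_econvex_interpolation:
  fixes h :: "'a::real_inner \<Rightarrow> ereal"
  assumes conv: "econvex (\<lambda>x. h x - ereal (\<mu> / 2 * (norm x)^2))"
    and fin: "\<And>x. h x \<noteq> -\<infinity>" and a: "h u = ereal a" and b: "h w = ereal b"
    and t: "0 \<le> t" "t \<le> 1"
  obtains e where "h ((1 - t) *\<^sub>R u + t *\<^sub>R w) = ereal e"
    "e \<le> (1 - t) * a + t * b - \<mu> / 2 * ((t - t^2) * (norm (w - u))^2)"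
proof -
  let ?x = "(1 - t) *\<^sub>R u + t *\<^sub>R w"
  define d where "d = w - u"
  have x: "?x = u + t *\<^sub>R d" and w: "w = u + d" by (simp_all add: d_def algebra_simps)
  have "h ?x - ereal (\<mu> / 2 * (norm ?x)^2)
      \<le> ereal (1 - t) * (h u - ereal (\<mu> / 2 * (norm u)^2))
        + ereal t * (h w - ereal (\<mu> / 2 * (norm w)^2))"
    using conv t unfolding econvex_def by blast
  then have *: "h ?x - ereal (\<mu> / 2 * (norm ?x)^2)
      \<le> ereal ((1 - t) * (a - \<mu> / 2 * (norm u)^2) + t * (b - \<mu> / 2 * (norm w)^2))"
    by (simp add: a b)
  then obtain e where e: "h ?x = ereal e" using fin[of ?x] by (cases "h ?x") auto
  have "e - \<mu> / 2 * (norm ?x)^2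
      \<le> (1 - t) * (a - \<mu> / 2 * (norm u)^2) + t * (b - \<mu> / 2 * (norm w)^2)"
    using * unfolding e by simp
  also have "\<dots> = (1 - t) * a + t * b
      - \<mu> / 2 * ((t - t^2) * (norm d)^2) - \<mu> / 2 * (norm ?x)^2"
    unfolding x unfolding w unfolding power2_norm_eq_inner
    by (simp add: inner_add_left inner_add_right inner_commute
        algebra_simps power2_eq_square add_divide_distrib diff_divide_distrib)
  finally show ?thesis using e that by (simp add: d_def)
qed

lemma strongly_econvex_imp_econvex:
  fixes f :: "'a::real_inner \<Rightarrow> ereal"
  assumes "strongly_econvex \<mu> f" and fin: "\<And>x. f x \<noteq> -\<infinity>"
  shows "econvex f"
  unfolding econvex_def
proof clarify
  fix x y and t :: real assume t: "0 \<le> t" "t \<le> 1"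
  from assms(1) have conv: "econvex (\<lambda>x. f x - ereal (\<mu> / 2 * (norm x)^2))" and "0 < \<mu>"
    by (auto simp: strongly_econvex_def)
  consider "t = 0" | "t = 1" | "0 < t" "t < 1" "f x = \<infinity> \<or> f y = \<infinity>"
    | a b where "f x = ereal a" "f y = ereal b"
    using t fin[of x] fin[of y] by (cases "f x"; cases "f y") force+
  then show "f ((1 - t) *\<^sub>R x + t *\<^sub>R y) \<le> ereal (1 - t) * f x + ereal t * f y"
  proof cases
    case 3
    then have "ereal (1 - t) * f x + ereal t * f y = \<infinity>"
      using fin[of x] fin[of y] by (cases "f x"; cases "f y") auto
    then show ?thesis by (simp only: ereal_less_eq(1))
  next
    case (4 a b)
    obtain e where "f ((1 - t) *\<^sub>R x + t *\<^sub>R y) = ereal e"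
      and "e \<le> (1 - t) * a + t * b - \<mu> / 2 * ((t - t^2) * (norm (y - x))^2)"
      using strongly_econvex_interpolation[OF conv fin 4 t] .
    moreover have "0 \<le> \<mu> / 2 * ((t - t^2) * (norm (y - x))^2)"
      using \<open>0 < \<mu>\<close> t by (simp add: power2_eq_square mult_left_le_one_le)
    ultimately show ?thesis using 4 by simp
  qed (simp_all add: one_ereal_def[symmetric] zero_ereal_def[symmetric])
qed

text \<open>
  Optimality of a proximal point, with the strong convexity modulus retained: the objective is
  compared with its values on the segment from \<open>u\<close> to \<open>w\<close>.
\<close>

lemma econvex_prox_subgradient:
  fixes h :: "'a::real_inner \<Rightarrow> ereal"
  assumes conv: "econvex (\<lambda>x. h x - ereal (\<mu> / 2 * (norm x)^2))"
    and u: "u \<in> prox \<gamma> h s" and "0 < \<gamma>" and fin: "\<And>x. h x \<noteq> -\<infinity>"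
    and a: "h u = ereal a" and b: "h w \<le> ereal b"
  shows "a + (1 / \<gamma>) * ((s - u) \<bullet> (w - u)) + \<mu> / 2 * (norm (w - u))^2 \<le> b"
proof -
  define d where "d = w - u"
  have "a + (1 / \<gamma>) * ((s - u) \<bullet> d) + \<mu> / 2 * (norm d)^2 - b \<le> 0"
  proof (rule nonpos_if_linear_le_quadratic)
    fix t :: real assume t: "0 < t" "t \<le> 1"
    let ?x = "(1 - t) *\<^sub>R u + t *\<^sub>R w"
    have x: "?x = u + t *\<^sub>R d" by (simp add: d_def algebra_simps)
    obtain b' where b': "h w = ereal b'" "b' \<le> b" using b fin[of w] by (cases "h w") auto
    obtain e where e: "h ?x = ereal e"
      and 1: "e \<le> (1 - t) * a + t * b' - \<mu> / 2 * ((t - t^2) * (norm d)^2)"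
      using strongly_econvex_interpolation[OF conv fin a b'(1), of t] t by (auto simp: d_def)
    have "a + 1 / (2 * \<gamma>) * (norm (u - s))^2 \<le> e + 1 / (2 * \<gamma>) * (norm (?x - s))^2"
      using prox_minimal[OF u a] e by simp
    moreover have "1 / (2 * \<gamma>) * (norm (?x - s))^2 = 1 / (2 * \<gamma>) * (norm (u - s))^2
        - t * (1 / \<gamma> * ((s - u) \<bullet> d)) + t^2 * (1 / (2 * \<gamma>) * (norm d)^2)"
      using \<open>0 < \<gamma>\<close> quadratic_recentre[of ?x s u] unfolding x
      by (simp add: power_mult_distrib field_simps inner_commute inner_diff_right)
    ultimately have "t * (a + (1 / \<gamma>) * ((s - u) \<bullet> d) + \<mu> / 2 * (norm d)^2 - b')
      \<le> t^2 * (1 / (2 * \<gamma>) * (norm d)^2 + \<mu> / 2 * (norm d)^2)"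
      using 1 by (simp add: algebra_simps)
    moreover have "t * b' \<le> t * b" using b' t by simp
    ultimately show "t * (a + (1 / \<gamma>) * ((s - u) \<bullet> d) + \<mu> / 2 * (norm d)^2 - b)
      \<le> t^2 * (1 / (2 * \<gamma>) * (norm d)^2 + \<mu> / 2 * (norm d)^2)"
      by (simp add: algebra_simps)
  qed
  then show ?thesis by (simp add: d_def)
qed

section \<open>The envelope as a real-valued function\<close>

definition dr_coupling :: "real \<Rightarrow> 'a::real_inner \<Rightarrow> 'a \<Rightarrow> 'a \<Rightarrow> real" where
  "dr_coupling \<gamma> s u v = 1 / \<gamma> * ((s - u) \<bullet> (v - u)) + 1 / (2 * \<gamma>) * (norm (v - u))^2"

text \<open>
  Completing the square shows that \<open>v \<in> prox \<gamma> \<phi>2 (2 u - s)\<close> minimizes \<open>\<phi>2\<close> plus the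
  coupling term. The envelope is therefore a minimum over \<open>v\<close>, which makes its value independent
  of the choice of \<open>v\<close>.
\<close>

lemma dr_coupling_reflection:
  "dr_coupling \<gamma> s u v
    = 1 / (2 * \<gamma>) * (norm (v - (2 *\<^sub>R u - s)))^2 - 1 / (2 * \<gamma>) * (norm (s - u))^2"
proof -
  define p w where "p = s - u" and "w = v - u"
  have e: "v - (2 *\<^sub>R u - s) = w + p" "s - u = p" "v - u = w"
    by (simp_all add: p_def w_def scaleR_2 algebra_simps)
  show ?thesis unfolding dr_coupling_def e power2_norm_eq_inner
    by (simp add: inner_add_left inner_add_right inner_commute add_divide_distrib)
qed

lemma prox_reflection_minimizes_coupling:
  assumes "v \<in> prox \<gamma> \<phi>2 (2 *\<^sub>R u - s)" "\<phi>2 v = ereal b" "\<phi>2 v' \<le> ereal b'"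
  shows "b + dr_coupling \<gamma> s u v \<le> b' + dr_coupling \<gamma> s u v'"
proof -
  note prox_minimal[OF assms]
  then show ?thesis unfolding dr_coupling_reflection by simp
qed

lemma DRE_eq_of_unique_prox:
  assumes uniq: "\<And>u u'. u \<in> prox \<gamma> \<phi>1 s \<Longrightarrow> u' \<in> prox \<gamma> \<phi>1 s \<Longrightarrow> u = u'"
    and fin: "\<And>x. \<phi>2 x \<noteq> -\<infinity>" and uv: "(u, v) \<in> DRS \<phi>1 \<phi>2 \<gamma> s"
    and a: "\<phi>1 u = ereal a" and b: "\<phi>2 v = ereal b"
  shows "DRE \<phi>1 \<phi>2 \<gamma> s = ereal (a + b + dr_coupling \<gamma> s u v)"
proof -
  define e0 where "e0 = ereal (a + b + dr_coupling \<gamma> s u v)"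
  have "DRE \<phi>1 \<phi>2 \<gamma> s = e0"
    unfolding DRE_def
  proof (rule the_equality)
    show "\<exists>(u, v)\<in>DRS \<phi>1 \<phi>2 \<gamma> s. e0 = \<phi>1 u + \<phi>2 v
        + ereal (1 / \<gamma> * ((s - u) \<bullet> (v - u)) + 1 / (2 * \<gamma>) * (norm (v - u))^2)"
      using uv by (intro bexI[of _ "(u, v)"]) (auto simp: a b e0_def dr_coupling_def)
  next
    fix e assume "\<exists>(u, v)\<in>DRS \<phi>1 \<phi>2 \<gamma> s. e = \<phi>1 u + \<phi>2 v
        + ereal (1 / \<gamma> * ((s - u) \<bullet> (v - u)) + 1 / (2 * \<gamma>) * (norm (v - u))^2)"
    then obtain u' v' where uv': "(u', v') \<in> DRS \<phi>1 \<phi>2 \<gamma> s"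
      and e: "e = \<phi>1 u' + \<phi>2 v' + ereal (dr_coupling \<gamma> s u' v')"
      by (auto simp: dr_coupling_def)
    have u': "u' = u" using uniq uv uv' by (auto simp: DRS_def)
    have v: "v \<in> prox \<gamma> \<phi>2 (2 *\<^sub>R u - s)" and v': "v' \<in> prox \<gamma> \<phi>2 (2 *\<^sub>R u - s)"
      using uv uv' u' by (auto simp: DRS_def)
    obtain b' where b': "\<phi>2 v' = ereal b'" using prox_finite[OF v' fin] .
    have "b + dr_coupling \<gamma> s u v = b' + dr_coupling \<gamma> s u v'"
      using prox_reflection_minimizes_coupling[OF v b] b'
        prox_reflection_minimizes_coupling[OF v' b'] b by (intro antisym) simp_all
    then show "e = e0" by (simp add: e u' a b' e0_def)
  qed
  then show ?thesis by (simp add: e0_def)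
qed

text \<open>
  What both cases share: all oracle calls succeed, and the first proximal map is single-valued and
  Lipschitz continuous.
\<close>

locale lipschitz_prox_dr =
  fixes \<phi>1 \<phi>2 :: "'a::real_inner \<Rightarrow> ereal" and \<gamma> K :: real
  assumes \<phi>1_fin: "\<phi>1 x \<noteq> -\<infinity>" and \<phi>2_fin: "\<phi>2 x \<noteq> -\<infinity>"
    and prox1_nonempty: "prox \<gamma> \<phi>1 s \<noteq> {}" and prox2_nonempty: "prox \<gamma> \<phi>2 s \<noteq> {}"
    and K_nonneg: "0 \<le> K"
    and prox1_lipschitz: "u \<in> prox \<gamma> \<phi>1 s \<Longrightarrow> u' \<in> prox \<gamma> \<phi>1 s' \<Longrightarrow> norm (u' - u) \<le> K * norm (s' - s)"
begin

lemma prox1_unique: "u \<in> prox \<gamma> \<phi>1 s \<Longrightarrow> u' \<in> prox \<gamma> \<phi>1 s \<Longrightarrow> u = u'"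
  using prox1_lipschitz[of u s u' s] by simp

definition u_of :: "'a \<Rightarrow> 'a" where "u_of s = (THE u. u \<in> prox \<gamma> \<phi>1 s)"

definition E :: "'a \<Rightarrow> real" where "E s = real_of_ereal (DRE \<phi>1 \<phi>2 \<gamma> s)"

lemma u_of: "u \<in> prox \<gamma> \<phi>1 s \<longleftrightarrow> u = u_of s"
proof -
  obtain u0 where "u0 \<in> prox \<gamma> \<phi>1 s" using prox1_nonempty by blast
  then have "\<And>u. u \<in> prox \<gamma> \<phi>1 s \<longleftrightarrow> u = u0" using prox1_unique by blast
  then show ?thesis unfolding u_of_def by simp
qed

lemma u_of_lipschitz: "K-lipschitz_on UNIV u_of"
  using prox1_lipschitz u_of K_nonneg by (auto intro!: lipschitz_onI simp: dist_norm)

lemma DRS_nonempty: "DRS \<phi>1 \<phi>2 \<gamma> s \<noteq> {}"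
  using prox1_nonempty prox2_nonempty unfolding DRS_def by fast

lemma DRS_cases:
  obtains u v where "(u, v) \<in> DRS \<phi>1 \<phi>2 \<gamma> s"
  using DRS_nonempty[of s] by fast

lemma DRS_D:
  assumes "(u, v) \<in> DRS \<phi>1 \<phi>2 \<gamma> s"
  shows "u \<in> prox \<gamma> \<phi>1 s" "v \<in> prox \<gamma> \<phi>2 (2 *\<^sub>R u - s)" "u = u_of s"
  using assms u_of by (auto simp: DRS_def)

lemma DRS_finite:
  assumes "(u, v) \<in> DRS \<phi>1 \<phi>2 \<gamma> s"
  obtains a b where "\<phi>1 u = ereal a" "\<phi>2 v = ereal b"
proof -
  obtain a where "\<phi>1 u = ereal a" using prox_finite[OF DRS_D(1)[OF assms] \<phi>1_fin] .
  moreover obtain b where "\<phi>2 v = ereal b" using prox_finite[OF DRS_D(2)[OF assms] \<phi>2_fin] .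
  ultimately show ?thesis by (rule that)
qed

lemma DRE_eq_E: "DRE \<phi>1 \<phi>2 \<gamma> s = ereal (E s)"
proof -
  obtain u v where uv: "(u, v) \<in> DRS \<phi>1 \<phi>2 \<gamma> s" using DRS_cases .
  obtain a b where ab: "\<phi>1 u = ereal a" "\<phi>2 v = ereal b" using DRS_finite[OF uv] .
  show ?thesis
    using DRE_eq_of_unique_prox[OF prox1_unique \<phi>2_fin uv ab] by (simp add: E_def)
qed

lemma E_eq:
  assumes "(u, v) \<in> DRS \<phi>1 \<phi>2 \<gamma> s" "\<phi>1 u = ereal a" "\<phi>2 v = ereal b"
  shows "E s = a + b + dr_coupling \<gamma> s u v"
  using DRE_eq_of_unique_prox[OF prox1_unique \<phi>2_fin assms] by (simp add: E_def)

lemma E_le: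
  assumes "\<phi>1 (u_of s) = ereal a" "\<phi>2 v \<le> ereal b"
  shows "E s \<le> a + b + dr_coupling \<gamma> s (u_of s) v"
proof -
  obtain u' v' where uv': "(u', v') \<in> DRS \<phi>1 \<phi>2 \<gamma> s" using DRS_cases .
  obtain a' b' where ab': "\<phi>1 u' = ereal a'" "\<phi>2 v' = ereal b'" using DRS_finite[OF uv'] .
  show ?thesis
    using prox_reflection_minimizes_coupling[OF DRS_D(2)[OF uv'] ab'(2) assms(2)]
      E_eq[OF uv' ab'] assms(1) ab'(1) DRS_D(3)[OF uv'] by simp
qed

end

section \<open>Quadratic models of the envelope\<close>

text \<open>
  The last term cancels the linear part of \<open>\<phi>\<^sub>1 u' - \<phi>\<^sub>1 u\<close>, since \<open>(s' - u') / \<gamma>\<close> is the gradient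
  of \<open>\<phi>\<^sub>1\<close> at \<open>u'\<close>.
\<close>

lemma dr_coupling_change_smooth:
  fixes s s' u u' v :: "'a::real_inner"
  defines "d \<equiv> u' - u" and "h \<equiv> s' - s - (u' - u)"
  shows "dr_coupling \<gamma> s' u' v - dr_coupling \<gamma> s u v
    = 1 / \<gamma> * ((norm d)^2 / 2 + (v - u) \<bullet> (h - d) - (s' - u') \<bullet> d)"
proof -
  define q w where "q = s' - u'" and "w = v - u"
  have e: "s' - u' = q" "v - u = w" "v - u' = w - d" "s - u = q - h"
    by (simp_all add: d_def h_def q_def w_def algebra_simps)
  show ?thesis
    unfolding dr_coupling_def e power2_norm_eq_inner
    by (simp add: inner_diff_left inner_diff_right inner_commute algebra_simps
        add_divide_distrib diff_divide_distrib)
qed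

text \<open>
  The two products added on the left are the linear lower bounds on the changes of \<open>\<phi>\<^sub>1\<close> and
  \<open>\<phi>\<^sub>2\<close>. The square collects everything that depends on \<open>v'\<close>, so dropping it leaves a lower bound
  in terms of \<open>d\<close>, \<open>h\<close> and \<open>w\<close> alone.
\<close>

lemma dr_coupling_change_strongly_convex:
  fixes s s' u u' v v' :: "'a::real_inner"
  defines "d \<equiv> u' - u" and "h \<equiv> s' - s - (u' - u)" and "w \<equiv> v - u"
  shows "dr_coupling \<gamma> s' u' v' - dr_coupling \<gamma> s u v
      + 1 / \<gamma> * ((s - u) \<bullet> d) + 1 / \<gamma> * ((2 *\<^sub>R u - s - v) \<bullet> (v' - v))
    = 1 / \<gamma> * ((norm (v' - u' - (w - h)))^2 / 2 - (norm h)^2 / 2 + w \<bullet> (h - d))"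
proof -
  define p where "p = s - u"
  define w' where "w' = v' - u'"
  have e: "s' - u' = p + h" "2 *\<^sub>R u - s - v = - p - w" "v' - v = w' - w + d" "s - u = p"
     "v' - u' = w'" "v - u = w"
    by (simp_all add: d_def h_def w_def p_def w'_def scaleR_2 algebra_simps)
  show ?thesis
    unfolding dr_coupling_def e power2_norm_eq_inner
    by (simp add: inner_diff_left inner_diff_right inner_add_left inner_add_right inner_commute
        algebra_simps add_divide_distrib diff_divide_distrib)
qed

text \<open>
  The hypothesis \<open>\<lambda> w = d + h\<close> is how a nominal step of length \<open>\<lambda>\<close> looks in these variables.
\<close>

lemma relaxation_identity:
  fixes d h w :: "'a::real_inner"
  assumes "lam *\<^sub>R w = d + h" "0 < lam"
  shows "w \<bullet> (h - d) = ((norm h)^2 - (norm d)^2) / lam"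
proof -
  have "lam * (w \<bullet> (h - d)) = (d + h) \<bullet> (h - d)" by (metis assms(1) inner_scaleR_left)
  also have "\<dots> = (norm h)^2 - (norm d)^2"
    by (simp add: power2_norm_eq_inner inner_diff_right inner_diff_left inner_add_left inner_add_right inner_commute)
  finally show ?thesis using assms(2) by (simp add: field_simps)
qed

lemma relaxation_norm_bound:
  fixes d h w :: "'a::real_inner"
  assumes "lam *\<^sub>R w = d + h" "0 < lam" "0 \<le> \<alpha>" "norm h \<le> \<alpha> * norm d" "0 \<le> \<kappa>"
  shows "lam / (1 + \<alpha>)^2 * \<kappa> * (norm w)^2 \<le> \<kappa> * (norm d)^2 / lam"
proof -
  have "lam * norm w = norm (d + h)" by (metis assms(1,2) abs_of_pos norm_scaleR)
  also have "\<dots> \<le> (1 + \<alpha>) * norm d"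
    using norm_triangle_ineq[of d h] assms(4) by (simp add: algebra_simps)
  finally have "lam * norm w / (1 + \<alpha>) \<le> norm d"
    using assms(3) by (simp add: pos_divide_le_eq mult.commute)
  then have "(lam * norm w / (1 + \<alpha>))^2 \<le> (norm d)^2"
    using assms(2,3) by (intro power_mono) auto
  then have "(lam * norm w)^2 / (1 + \<alpha>)^2 \<le> (norm d)^2"
    by (simp add: power_divide)
  then have "(\<kappa> / lam) * ((lam * norm w)^2 / (1 + \<alpha>)^2) \<le> (\<kappa> / lam) * (norm d)^2"
    using assms(2,5) by (intro mult_left_mono) auto
  then show ?thesis using assms(2) by (simp add: power_mult_distrib power2_eq_square field_simps)
qed

text \<open>
  By the identity above the total coefficient of \<open>\<parallel>h\<parallel>\<^sup>2\<close> is \<open>1 / \<lambda> - 1 / (2 \<alpha>)\<close>, which is positive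
  only for \<open>\<alpha> > \<lambda> / 2\<close>; only then is \<open>\<parallel>h\<parallel> \<le> \<alpha> \<parallel>d\<parallel>\<close> spent on it. This is where the maximum in the
  constant comes from. The strongly convex case uses the bound with \<open>d\<close> and \<open>h\<close> exchanged.
\<close>

lemma decrease_bound_convex:
  fixes d h w :: "'a::real_inner"
  assumes rel: "lam *\<^sub>R w = d + h" and "0 < lam" and \<alpha>: "0 \<le> \<alpha>"
    and hd: "norm h \<le> \<alpha> * norm d"
    and \<kappa>: "0 \<le> (2 - lam) / 2 - \<alpha> * max (\<alpha> - lam / 2) 0"
  shows "(norm d)^2 / 2 - (norm h)^2 / (2 * \<alpha>) + w \<bullet> (h - d)
    \<le> - (lam / (1 + \<alpha>)^2 * ((2 - lam) / 2 - \<alpha> * max (\<alpha> - lam / 2) 0)) * (norm w)^2"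
proof -
  define m where "m = max (\<alpha> - lam / 2) 0"
  have hh: "(norm h)^2 \<le> \<alpha>^2 * (norm d)^2"
    using power_mono[OF hd, of 2] by (simp add: power_mult_distrib)
  have "(1 - lam / (2 * \<alpha>)) * (norm h)^2 \<le> \<alpha> * m * (norm d)^2"
  proof (cases "\<alpha> = 0")
    case True
    then show ?thesis using hh by simp
  next
    case False
    have "1 - lam / (2 * \<alpha>) = (\<alpha> - lam / 2) / \<alpha>" using False by (simp add: field_simps)
    also have "\<dots> \<le> m / \<alpha>" using \<alpha> by (intro divide_right_mono) (auto simp: m_def)
    finally have "(1 - lam / (2 * \<alpha>)) * (norm h)^2 \<le> (m / \<alpha>) * (norm h)^2"
      by (intro mult_right_mono) auto
    also have "\<dots> \<le> (m / \<alpha>) * (\<alpha>^2 * (norm d)^2)"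
      using \<alpha> hh by (intro mult_left_mono) (auto simp: m_def)
    also have "\<dots> = \<alpha> * m * (norm d)^2" using False by (simp add: power2_eq_square)
    finally show ?thesis .
  qed
  then have "(1 - lam / (2 * \<alpha>)) * (norm h)^2 / lam \<le> \<alpha> * m * (norm d)^2 / lam"
    using \<open>0 < lam\<close> by (intro divide_right_mono) auto
  then have "(norm h)^2 / lam - (norm h)^2 / (2 * \<alpha>) \<le> \<alpha> * m * (norm d)^2 / lam"
    using \<open>0 < lam\<close> by (simp add: left_diff_distrib diff_divide_distrib)
  moreover have "((2 - lam) / 2 - \<alpha> * m) * (norm d)^2 / lam
      = (norm d)^2 / lam - (norm d)^2 / 2 - \<alpha> * m * (norm d)^2 / lam"
    using \<open>0 < lam\<close> by (simp add: field_simps)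
  ultimately show ?thesis
    using relaxation_identity[OF rel \<open>0 < lam\<close>]
      relaxation_norm_bound[OF rel \<open>0 < lam\<close> \<alpha> hd \<kappa>]
    unfolding m_def by (simp add: diff_divide_distrib)
qed

text \<open>
  Here \<open>\<parallel>h\<parallel> \<le> \<alpha> \<parallel>d\<parallel>\<close> makes the left-hand side at most
  \<open>- (1 + \<alpha>) ((2 - \<lambda>) / 2 - \<alpha>) \<parallel>d\<parallel>\<^sup>2 / \<lambda>\<close>; the surplus factor \<open>1 + \<alpha>\<close> is given away.
\<close>

lemma decrease_bound_nonconvex:
  fixes d h w :: "'a::real_inner"
  assumes rel: "lam *\<^sub>R w = d + h" and "0 < lam" and \<alpha>: "0 \<le> \<alpha>"
    and hd: "norm h \<le> \<alpha> * norm d"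
    and \<kappa>: "0 \<le> (2 - lam) / 2 - \<alpha>"
  shows "(norm d)^2 / 2 + \<alpha> / 2 * (norm d)^2 + w \<bullet> (h - d)
    \<le> - (lam / (1 + \<alpha>)^2 * ((2 - lam) / 2 - \<alpha>)) * (norm w)^2"
proof -
  have hh: "(norm h)^2 \<le> \<alpha>^2 * (norm d)^2"
    using power_mono[OF hd, of 2] by (simp add: power_mult_distrib)
  then have "(norm h)^2 / lam \<le> \<alpha>^2 * (norm d)^2 / lam"
    using \<open>0 < lam\<close> by (intro divide_right_mono) auto
  moreover have "(norm d)^2 / 2 + \<alpha> / 2 * (norm d)^2 + (\<alpha>^2 * (norm d)^2 / lam - (norm d)^2 / lam)
      = - ((1 + \<alpha>) * (((2 - lam) / 2 - \<alpha>) * (norm d)^2 / lam))"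
    using \<open>0 < lam\<close> by (simp add: field_simps power2_eq_square)
  moreover have "((2 - lam) / 2 - \<alpha>) * (norm d)^2 / lam
      \<le> (1 + \<alpha>) * (((2 - lam) / 2 - \<alpha>) * (norm d)^2 / lam)"
  proof -
    have "0 \<le> \<alpha> * (((2 - lam) / 2 - \<alpha>) * (norm d)^2 / lam)"
      using assms by (intro mult_nonneg_nonneg divide_nonneg_pos) auto
    then show ?thesis by (simp only: distrib_right mult_1 le_add_same_cancel1)
  qed
  ultimately show ?thesis
    using relaxation_identity[OF rel \<open>0 < lam\<close>]
      relaxation_norm_bound[OF rel \<open>0 < lam\<close> \<alpha> hd \<kappa>]
    by (simp add: diff_divide_distrib)
qed

text \<open>
  The model is a continuous function of \<open>s'\<close>, so the strict decrease that it guarantees at \<open>z\<close>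
  spreads to a neighbourhood of \<open>z\<close>.
\<close>

lemma eventually_decrease_of_quadratic_model:
  fixes P :: "'a::real_inner \<Rightarrow> 'a" and E :: "'a \<Rightarrow> real"
  defines "D s s' \<equiv> P s' - P s" and "H s s' \<equiv> s' - s - (P s' - P s)"
  assumes lip: "K-lipschitz_on UNIV P"
    and model: "\<And>s'. E s' \<le> E s + 1 / \<gamma> *
      (A * (norm (D s s'))^2 + B * (norm (H s s'))^2 + \<mu> * (w \<bullet> (H s s' - D s s')))"
    and nominal: "A * (norm (D s z))^2 + B * (norm (H s z))^2 + \<mu> * (w \<bullet> (H s z - D s z))
      \<le> - C * (norm w)^2"
    and "c < C" "w \<noteq> 0" "0 < \<gamma>"
  shows "\<forall>\<^sub>F s' in nhds z. E s' \<le> E s - c / \<gamma> * (norm w)^2"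
proof -
  define Q where "Q s' = A * (norm (D s s'))^2 + B * (norm (H s s'))^2
    + \<mu> * (w \<bullet> (H s s' - D s s'))" for s'
  have contP: "continuous_on UNIV P" using lip by (rule lipschitz_on_continuous_on)
  have "continuous_on UNIV Q" unfolding Q_def D_def H_def
    by (intro continuous_intros continuous_on_subset[OF contP]) auto
  then have "(Q \<longlongrightarrow> Q z) (nhds z)" by (auto simp: tendsto_nhds_iff continuous_on_def)
  moreover have "Q z < - c * (norm w)^2"
    using nominal assms(6,7) unfolding Q_def[symmetric]
    by (smt (verit) mult_strict_right_mono zero_less_norm_iff zero_less_power)
  ultimately have "\<forall>\<^sub>F s' in nhds z. Q s' < - c * (norm w)^2" by (rule order_tendstoD(2))
  then show ?thesis
  proof eventually_elim
    case (elim s')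
    then have "1 / \<gamma> * Q s' \<le> 1 / \<gamma> * (- c * (norm w)^2)"
      using \<open>0 < \<gamma>\<close> by (intro mult_left_mono) auto
    then show ?case using model[of s'] unfolding Q_def[symmetric] by simp
  qed
qed

section \<open>The smooth case\<close>

locale smooth_dr =
  fixes f :: "'a::euclidean_space \<Rightarrow> real" and G :: "'a \<Rightarrow> 'a" and L \<gamma> :: real
    and \<phi>2 :: "'a \<Rightarrow> ereal" and xmin :: 'a and \<phi>min :: real
  assumes grad: "GDERIV f x :> G x" and lip: "L-lipschitz_on UNIV G"
    and \<phi>2_fin: "\<phi>2 x \<noteq> -\<infinity>" and \<phi>2_lsc: "lsc \<phi>2"
    and \<gamma>_pos: "0 < \<gamma>" and \<gamma>L: "\<gamma> * L < 1"
    and \<phi>min: "ereal (f xmin) + \<phi>2 xmin = ereal \<phi>min"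
    and minimal: "\<phi>2 x \<le> ereal b \<Longrightarrow> \<phi>min \<le> f x + b"
begin

abbreviation \<phi>1 :: "'a \<Rightarrow> ereal" where "\<phi>1 \<equiv> \<lambda>x. ereal (f x)"

lemma L_nonneg: "0 \<le> L" using lipschitz_on_nonneg[OF lip] .

lemma prox1_forward: "u \<in> prox \<gamma> \<phi>1 s \<Longrightarrow> s - u = \<gamma> *\<^sub>R G u"
  using prox_smooth_gradient[OF grad lip _ \<gamma>_pos] .

lemma gradient_step_bound:
  assumes "u \<in> prox \<gamma> \<phi>1 s" "u' \<in> prox \<gamma> \<phi>1 s'"
  shows "norm (s' - s - (u' - u)) \<le> \<gamma> * L * norm (u' - u)"
proof -
  have "s' - s - (u' - u) = \<gamma> *\<^sub>R (G u' - G u)"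
    using prox1_forward[OF assms(1)] prox1_forward[OF assms(2)] by (simp add: algebra_simps)
  then show ?thesis using lipschitz_onD[OF lip, of u' u] \<gamma>_pos by (simp add: dist_norm)
qed

lemma prox1_stable:
  assumes "u \<in> prox \<gamma> \<phi>1 s" "u' \<in> prox \<gamma> \<phi>1 s'"
  shows "(1 - \<gamma> * L) * norm (u' - u) \<le> norm (s' - s)"
proof -
  have "norm (u' - u) \<le> norm (s' - s) + norm (s' - s - (u' - u))"
    using norm_triangle_ineq4[of "s' - s" "s' - s - (u' - u)"] by simp
  then show ?thesis using gradient_step_bound[OF assms] by (simp add: algebra_simps)
qed

lemma prox1_nonempty: "prox \<gamma> \<phi>1 s \<noteq> {}"
proof (rule prox_nonempty)
  have "continuous_on UNIV f"
    using grad unfolding gderiv_def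
    by (intro continuous_at_imp_continuous_on) (auto intro: has_derivative_continuous)
  then show "lsc \<phi>1" by (rule lsc_ereal_continuous)
  show "ereal (f 0 + G 0 \<bullet> (w - 0) - L / 2 * (norm (w - 0))^2) \<le> \<phi>1 w" for w
    using descent_lemma_lower[OF grad lip, of 0 w] by simp
qed (use \<gamma>_pos \<gamma>L in auto)

lemma prox2_nonempty: "prox \<gamma> \<phi>2 s \<noteq> {}"
proof (rule prox_nonempty[OF \<phi>2_lsc \<phi>2_fin])
  show "\<phi>2 xmin < \<infinity>" using \<phi>min by (cases "\<phi>2 xmin") auto
  fix w
  (* phi2 >= phimin - f, and the descent lemma bounds f above by a quadratic of curvature L *)
  show "ereal ((\<phi>min - f xmin) + (- G xmin) \<bullet> (w - xmin) - L / 2 * (norm (w - xmin))^2) \<le> \<phi>2 w"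
  proof (cases "\<phi>2 w")
    case (real b)
    then show ?thesis using minimal[of w b] descent_lemma[OF grad lip, of w xmin] by simp
  qed (use \<phi>2_fin in auto)
qed (use \<gamma>_pos \<gamma>L in auto)

sublocale lipschitz_prox_dr \<phi>1 \<phi>2 \<gamma> "1 / (1 - \<gamma> * L)"
proof
  fix s s' u u' assume "u \<in> prox \<gamma> \<phi>1 s" "u' \<in> prox \<gamma> \<phi>1 s'"
  then show "norm (u' - u) \<le> 1 / (1 - \<gamma> * L) * norm (s' - s)"
    using prox1_stable[of u s u' s'] \<gamma>L by (simp add: field_simps)
qed (use prox1_nonempty prox2_nonempty \<phi>2_fin \<gamma>L in auto)

text \<open>
  As \<open>L < 1 / \<gamma>\<close>, the descent lemma bounds the envelope below by \<open>\<phi> v\<close>.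
\<close>

lemma min_le_E: "\<phi>min \<le> E s"
proof -
  obtain u v where uv: "(u, v) \<in> DRS \<phi>1 \<phi>2 \<gamma> s" using DRS_nonempty[of s] by fast
  then have u: "s - u = \<gamma> *\<^sub>R G u" using prox1_forward by (auto simp: DRS_def)
  obtain b where "\<phi>2 v = ereal b" using DRS_finite[OF uv] .
  note b = this E_eq[OF uv refl this]
  have "f v \<le> f u + G u \<bullet> (v - u) + L / 2 * (norm (v - u))^2" by (rule descent_lemma[OF grad lip])
  also have "L / 2 * (norm (v - u))^2 \<le> 1 / (2 * \<gamma>) * (norm (v - u))^2"
    using \<gamma>L \<gamma>_pos by (intro mult_right_mono) (auto simp: field_simps)
  finally have "f v + b \<le> E s" using b(2) \<gamma>_pos by (simp add: dr_coupling_def u)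
  then show ?thesis using minimal[of v b] b(1) by simp
qed

text \<open>
  The bound on the Bregman-type bracket is left open: the convex and the nonconvex case differ
  only in the coefficients \<open>A\<close> and \<open>B\<close>.
\<close>

lemma E_quadratic_model:
  assumes "(u, v) \<in> DRS \<phi>1 \<phi>2 \<gamma> s"
    and bracket: "\<And>x y. \<gamma> * (f x - f y - G x \<bullet> (x - y))
      \<le> A * (norm (x - y))^2 + B * (norm (\<gamma> *\<^sub>R (G x - G y)))^2"
  defines "d s' \<equiv> u_of s' - u_of s" and "h s' \<equiv> s' - s - (u_of s' - u_of s)"
  shows "E s' \<le> E s + 1 / \<gamma> * ((A + 1/2) * (norm (d s'))^2 + B * (norm (h s'))^2
      + 1 * ((v - u) \<bullet> (h s' - d s')))"
proof -
  have u: "u = u_of s" using assms(1) u_of by (auto simp: DRS_def)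
  obtain b where "\<phi>2 v = ereal b" using DRS_finite[OF assms(1)] .
  note b = this E_eq[OF assms(1) refl this]
  have fw: "s - u_of s = \<gamma> *\<^sub>R G (u_of s)" for s using prox1_forward u_of by blast
  have h: "h s' = \<gamma> *\<^sub>R (G (u_of s') - G u)"
    using fw[of s] fw[of s'] by (simp add: h_def u algebra_simps)
  have "E s' \<le> f (u_of s') + b + dr_coupling \<gamma> s' (u_of s') v" using E_le[OF refl] b(1) by simp
  then have "E s' - E s \<le> f (u_of s') - f u
      + (dr_coupling \<gamma> s' (u_of s') v - dr_coupling \<gamma> s u v)"
    using b(2) by simp
  also have "\<dots> = f (u_of s') - f u
      + 1 / \<gamma> * ((norm (d s'))^2 / 2 + (v - u) \<bullet> (h s' - d s') - (s' - u_of s') \<bullet> d s')"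
    unfolding dr_coupling_change_smooth by (simp add: d_def h_def u)
  also have "\<dots> = 1 / \<gamma> * (\<gamma> * (f (u_of s') - f u - G (u_of s') \<bullet> d s')
      + (norm (d s'))^2 / 2 + (v - u) \<bullet> (h s' - d s'))"
    using \<gamma>_pos by (simp add: fw field_simps)
  also have "\<dots> \<le> 1 / \<gamma> * ((A + 1/2) * (norm (d s'))^2 + B * (norm (h s'))^2
      + 1 * ((v - u) \<bullet> (h s' - d s')))"
    using bracket[of "u_of s'" u] \<gamma>_pos unfolding h
    by (intro mult_left_mono) (auto simp: d_def u distrib_right)
  finally show ?thesis by simp
qed

lemma decrease_near_nominal:
  assumes lam: "0 < lam" "lam < 2"
    and c: "0 < c" "c < dr_const \<phi>1 (\<gamma> * L) lam"
    and uv: "(u, v) \<in> DRS \<phi>1 \<phi>2 \<gamma> s" "u \<noteq> v"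
  shows "\<forall>\<^sub>F s' in nhds (nominal_point lam s u v). E s' \<le> E s - c / \<gamma> * (norm (u - v))^2"
proof -
  define \<alpha> where "\<alpha> = \<gamma> * L"
  define z where "z = nominal_point lam s u v"
  have \<alpha>: "0 \<le> \<alpha>" using \<gamma>_pos L_nonneg by (simp add: \<alpha>_def)
  have u: "u = u_of s" using uv u_of by (auto simp: DRS_def)
  have hd: "norm (z - s - (u_of z - u_of s)) \<le> \<alpha> * norm (u_of z - u_of s)"
    unfolding \<alpha>_def using gradient_step_bound u_of by blast
  have rel: "lam *\<^sub>R (v - u) = (u_of z - u_of s) + (z - s - (u_of z - u_of s))"
    by (simp add: z_def nominal_point_def algebra_simps)
  have Cpos: "0 < dr_const \<phi>1 \<alpha> lam" using c unfolding \<alpha>_def by simp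
  note eventually = eventually_decrease_of_quadratic_model[OF u_of_lipschitz E_quadratic_model[OF uv(1)] _
      c(2)[folded \<alpha>_def] _ \<gamma>_pos]
  show ?thesis
  proof (cases "econvex \<phi>1")
    case True
    have \<kappa>: "0 \<le> (2 - lam) / 2 - \<alpha> * max (\<alpha> - lam / 2) 0"
      using Cpos lam True \<alpha> by (auto simp: dr_const_def zero_less_mult_iff zero_less_divide_iff)
    (* for L = 0 the coefficient - 1 / (2 * alpha) and the difference of gradients both vanish *)
    have bracket: "\<gamma> * (f x - f y - G x \<bullet> (x - y))
      \<le> 0 * (norm (x - y))^2 + (- 1 / (2 * \<alpha>)) * (norm (\<gamma> *\<^sub>R (G x - G y)))^2" for x y
    proof -
      have "f x - f y - G x \<bullet> (x - y) \<le> - ((norm (G x - G y))^2 / (2 * L))"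
        using smooth_convex_cocoercive[OF grad lip True, of x y]
        by (simp add: inner_diff_right norm_minus_commute)
      then have "\<gamma> * (f x - f y - G x \<bullet> (x - y)) \<le> \<gamma> * - ((norm (G x - G y))^2 / (2 * L))"
        using \<gamma>_pos by (intro mult_left_mono) auto
      also have "\<dots> = - 1 / (2 * \<alpha>) * (norm (\<gamma> *\<^sub>R (G x - G y)))^2"
        unfolding norm_scaleR power_mult_distrib
        using \<gamma>_pos by (cases "L = 0") (simp_all add: \<alpha>_def power2_eq_square field_simps)
      finally show ?thesis by simp
    qed
    have "\<forall>\<^sub>F s' in nhds z. E s' \<le> E s - c / \<gamma> * (norm (v - u))^2"
      by (rule eventually[OF bracket])
        (use decrease_bound_convex[OF rel lam(1) \<alpha> hd \<kappa>] True uv(2) in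
          \<open>auto simp: dr_const_def\<close>)
    then show ?thesis by (simp add: z_def norm_minus_commute)
  next
    case False
    have \<kappa>: "0 \<le> (2 - lam) / 2 - \<alpha>"
      using Cpos lam False \<alpha> by (auto simp: dr_const_def zero_less_mult_iff zero_less_divide_iff)
    have bracket: "\<gamma> * (f x - f y - G x \<bullet> (x - y))
      \<le> \<alpha> / 2 * (norm (x - y))^2 + 0 * (norm (\<gamma> *\<^sub>R (G x - G y)))^2" for x y
    proof -
      have "f x - f y - G x \<bullet> (x - y) \<le> L / 2 * (norm (x - y))^2"
        using descent_lemma_lower[OF grad lip, of x y]
        by (simp add: inner_diff_right norm_minus_commute)
      then have "\<gamma> * (f x - f y - G x \<bullet> (x - y)) \<le> \<gamma> * (L / 2 * (norm (x - y))^2)"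
        using \<gamma>_pos by (intro mult_left_mono) auto
      then show ?thesis by (simp add: \<alpha>_def)
    qed
    have "\<forall>\<^sub>F s' in nhds z. E s' \<le> E s - c / \<gamma> * (norm (v - u))^2"
      by (rule eventually[OF bracket])
        (use decrease_bound_nonconvex[OF rel lam(1) \<alpha> hd \<kappa>] False uv(2) in
          \<open>auto simp: dr_const_def algebra_simps\<close>)
    then show ?thesis by (simp add: z_def norm_minus_commute)
  qed
qed

text \<open>
  The second proximal step gives \<open>(2 u - s - v) / \<gamma>\<close> as a subgradient of \<open>\<phi>\<^sub>2\<close> at \<open>v\<close>. Adding
  \<open>G v\<close> in place of \<open>G u = (s - u) / \<gamma>\<close> leaves \<open>(u - v) / \<gamma>\<close> and an error of size
  \<open>L \<parallel>u - v\<parallel>\<close>, which is at most \<open>\<parallel>u - v\<parallel> / \<gamma>\<close>.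
\<close>

lemma residual_subgradient:
  assumes "(u, v) \<in> DRS \<phi>1 \<phi>2 \<gamma> s"
  defines "q \<equiv> G v + (1 / \<gamma>) *\<^sub>R (2 *\<^sub>R u - s - v)"
  shows "q \<in> regular_subdiff (\<lambda>x. \<phi>1 x + \<phi>2 x) v" "norm q \<le> 2 / \<gamma> * norm (u - v)"
proof -
  have v: "v \<in> prox \<gamma> \<phi>2 (2 *\<^sub>R u - s)" using DRS_D(2)[OF assms(1)] .
  obtain b where b: "\<phi>2 v = ereal b" using DRS_finite[OF assms(1)] .
  show "q \<in> regular_subdiff (\<lambda>x. \<phi>1 x + \<phi>2 x) v"
  proof (rule regular_subdiff_of_quadratic_minorant)
    show "\<phi>1 v + \<phi>2 v = ereal (f v + b)" by (simp add: b)
    fix y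
    show "ereal (f v + b + q \<bullet> (y - v) - (L / 2 + 1 / (2 * \<gamma>)) * (norm (y - v))^2) \<le> \<phi>1 y + \<phi>2 y"
    proof (cases "\<phi>2 y")
      case (real b')
      have "b + 1 / (2 * \<gamma>) * (norm (v - (2 *\<^sub>R u - s)))^2
          \<le> b' + 1 / (2 * \<gamma>) * (norm (y - (2 *\<^sub>R u - s)))^2"
        by (rule prox_minimal[OF v b]) (simp add: real)
      also have "(norm (y - (2 *\<^sub>R u - s)))^2 = (norm (y - v))^2
          - 2 * ((2 *\<^sub>R u - s - v) \<bullet> (y - v)) + (norm (v - (2 *\<^sub>R u - s)))^2"
        unfolding quadratic_recentre[of y "2 *\<^sub>R u - s" v]
        by (simp add: inner_diff_left inner_diff_right inner_commute)
      finally have "b + (1 / \<gamma>) * ((2 *\<^sub>R u - s - v) \<bullet> (y - v)) - 1 / (2 * \<gamma>) * (norm (y - v))^2 \<le> b'"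
        by (simp add: algebra_simps)
      then show ?thesis
        using descent_lemma_lower[OF grad lip, of v y]
        by (simp add: real q_def inner_add_left distrib_right)
    qed (use \<phi>2_fin in auto)
  qed
  have su: "s - u = \<gamma> *\<^sub>R G u" using prox1_forward DRS_D(1)[OF assms(1)] .
  have "q = (G v - G u) + (1 / \<gamma>) *\<^sub>R (u - v)"
  proof -
    have e: "2 *\<^sub>R u - s - v = (u - v) - (s - u)" by (simp add: scaleR_2 algebra_simps)
    show ?thesis unfolding q_def e su using \<gamma>_pos by (simp add: scaleR_diff_right)
  qed
  then have "norm q \<le> norm (G v - G u) + norm ((1 / \<gamma>) *\<^sub>R (u - v))"
    by (simp only: norm_triangle_ineq)
  also have "\<dots> \<le> L * norm (u - v) + 1 / \<gamma> * norm (u - v)"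
    using lipschitz_onD[OF lip, of v u] \<gamma>_pos by (simp add: dist_norm norm_minus_commute)
  also have "L * norm (u - v) \<le> 1 / \<gamma> * norm (u - v)"
    using \<gamma>L \<gamma>_pos by (intro mult_right_mono) (auto simp: field_simps)
  finally show "norm q \<le> 2 / \<gamma> * norm (u - v)" by simp
qed

end

section \<open>The strongly convex case\<close>

text \<open>
  One oracle output \<open>(u0, v0)\<close> is part of the setting: its optimality conditions supply affine
  minorants of \<open>\<phi>1\<close> and \<open>\<phi>2\<close>, from which all further proximal points exist.
\<close>

locale strongly_convex_dr =
  fixes \<phi>1 \<phi>2 :: "'a::euclidean_space \<Rightarrow> ereal" and \<mu> \<gamma> :: real and x0 s0 u0 v0 :: 'a
  assumes \<phi>1_fin: "\<phi>1 x \<noteq> -\<infinity>" and \<phi>1_lsc: "lsc \<phi>1" and \<phi>1_sc: "strongly_econvex \<mu> \<phi>1"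
    and \<phi>2_fin: "\<phi>2 x \<noteq> -\<infinity>" and \<phi>2_lsc: "lsc \<phi>2" and \<phi>2_conv: "econvex \<phi>2"
    and dom: "\<phi>1 x0 < \<infinity>" "\<phi>2 x0 < \<infinity>"
    and \<gamma>\<mu>: "1 / \<mu> < \<gamma>"
    and start: "(u0, v0) \<in> DRS \<phi>1 \<phi>2 \<gamma> s0"
begin

lemma \<mu>_pos: "0 < \<mu>" using \<phi>1_sc by (simp add: strongly_econvex_def)

lemma \<gamma>\<mu>_gt_1: "1 < \<gamma> * \<mu>" using \<gamma>\<mu> \<mu>_pos by (simp add: field_simps)

lemma \<gamma>_pos: "0 < \<gamma>" using \<gamma>\<mu> \<mu>_pos by (metis less_trans zero_less_divide_1_iff)

lemma prox1_subgradient: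
  assumes "u \<in> prox \<gamma> \<phi>1 s" "\<phi>1 u = ereal a" "\<phi>1 w \<le> ereal b"
  shows "a + 1 / \<gamma> * ((s - u) \<bullet> (w - u)) + \<mu> / 2 * (norm (w - u))^2 \<le> b"
  using econvex_prox_subgradient[OF _ assms(1) \<gamma>_pos \<phi>1_fin assms(2,3)] \<phi>1_sc
  by (simp add: strongly_econvex_def)

lemma prox2_subgradient:
  assumes "v \<in> prox \<gamma> \<phi>2 s" "\<phi>2 v = ereal a" "\<phi>2 w \<le> ereal b"
  shows "a + 1 / \<gamma> * ((s - v) \<bullet> (w - v)) \<le> b"
  using econvex_prox_subgradient[of \<phi>2 0, OF _ assms(1) \<gamma>_pos \<phi>2_fin assms(2,3)] \<phi>2_conv
  by (simp add: zero_ereal_def[symmetric])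

lemma prox1_strongly_monotone:
  assumes "u \<in> prox \<gamma> \<phi>1 s" "u' \<in> prox \<gamma> \<phi>1 s'"
  shows "\<gamma> * \<mu> * (norm (u' - u))^2 \<le> (s' - s - (u' - u)) \<bullet> (u' - u)"
proof -
  obtain a where a: "\<phi>1 u = ereal a" using prox_finite[OF assms(1) \<phi>1_fin] .
  obtain a' where a': "\<phi>1 u' = ereal a'" using prox_finite[OF assms(2) \<phi>1_fin] .
  have "a + 1 / \<gamma> * ((s - u) \<bullet> (u' - u)) + \<mu> / 2 * (norm (u' - u))^2 \<le> a'"
    using prox1_subgradient[OF assms(1) a] a' by simp
  moreover have "a' + 1 / \<gamma> * ((s' - u') \<bullet> (u - u')) + \<mu> / 2 * (norm (u' - u))^2 \<le> a"
    using prox1_subgradient[OF assms(2) a', of u a] a by (simp add: norm_minus_commute)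
  ultimately have "\<mu> * (norm (u' - u))^2
      \<le> 1 / \<gamma> * (- ((s - u) \<bullet> (u' - u)) - (s' - u') \<bullet> (u - u'))"
    by (simp add: algebra_simps)
  also have "- ((s - u) \<bullet> (u' - u)) - (s' - u') \<bullet> (u - u') = (s' - s - (u' - u)) \<bullet> (u' - u)"
    by (simp add: inner_diff_left inner_diff_right inner_commute)
  finally show ?thesis using \<gamma>_pos by (simp add: field_simps)
qed

text \<open>
  Counterpart of the bound \<open>\<parallel>h\<parallel> \<le> \<alpha> \<parallel>d\<parallel>\<close> of the smooth case, with the roles of the change \<open>d\<close> of
  \<open>u\<close> and the change \<open>h\<close> of \<open>s - u\<close> exchanged.
\<close>

lemma prox1_contraction:
  assumes "u \<in> prox \<gamma> \<phi>1 s" "u' \<in> prox \<gamma> \<phi>1 s'"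
  shows "norm (u' - u) \<le> 1 / (\<gamma> * \<mu>) * norm (s' - s - (u' - u))"
proof (cases "u' = u")
  case False
  have "\<gamma> * \<mu> * (norm (u' - u))^2 \<le> norm (s' - s - (u' - u)) * norm (u' - u)"
    using prox1_strongly_monotone[OF assms] norm_cauchy_schwarz order_trans by blast
  then have "\<gamma> * \<mu> * norm (u' - u) \<le> norm (s' - s - (u' - u))"
    using False by (simp add: power2_eq_square)
  then show ?thesis using \<gamma>\<mu>_gt_1 by (simp add: pos_le_divide_eq mult.commute)
qed (use \<gamma>\<mu>_gt_1 in simp)

lemma prox1_nonexpansive:
  assumes "u \<in> prox \<gamma> \<phi>1 s" "u' \<in> prox \<gamma> \<phi>1 s'"
  shows "norm (u' - u) \<le> norm (s' - s)"
proof (cases "u' = u")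
  case False
  have "0 \<le> \<gamma> * \<mu> * (norm (u' - u))^2" using \<gamma>\<mu>_gt_1 by simp
  also have "\<dots> \<le> (s' - s - (u' - u)) \<bullet> (u' - u)" by (rule prox1_strongly_monotone[OF assms])
  also have "\<dots> = (s' - s) \<bullet> (u' - u) - (norm (u' - u))^2"
    by (simp add: inner_diff_left power2_norm_eq_inner)
  finally have "(norm (u' - u))^2 \<le> norm (s' - s) * norm (u' - u)"
    using norm_cauchy_schwarz[of "s' - s" "u' - u"] by simp
  then show ?thesis using False by (simp add: power2_eq_square)
qed simp

lemma start_prox: "u0 \<in> prox \<gamma> \<phi>1 s0" "v0 \<in> prox \<gamma> \<phi>2 (2 *\<^sub>R u0 - s0)"
  using start by (auto simp: DRS_def)

lemma prox1_nonempty: "prox \<gamma> \<phi>1 s \<noteq> {}"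
proof -
  obtain a where a: "\<phi>1 u0 = ereal a" using prox_finite[OF start_prox(1) \<phi>1_fin] .
  show ?thesis
  proof (rule prox_nonempty[OF \<phi>1_lsc \<phi>1_fin dom(1) \<gamma>_pos])
    fix w
    show "ereal (a + ((1 / \<gamma>) *\<^sub>R (s0 - u0)) \<bullet> (w - u0) - 0 / 2 * (norm (w - u0))^2) \<le> \<phi>1 w"
    proof (cases "\<phi>1 w")
      case (real b)
      have "0 \<le> \<mu> / 2 * (norm (w - u0))^2" using \<mu>_pos by simp
      then show ?thesis using prox1_subgradient[OF start_prox(1) a, of w b] real by simp
    qed (use \<phi>1_fin in auto)
  qed simp
qed

lemma prox2_nonempty: "prox \<gamma> \<phi>2 s \<noteq> {}"
proof -
  obtain a where a: "\<phi>2 v0 = ereal a" using prox_finite[OF start_prox(2) \<phi>2_fin] .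
  show ?thesis
  proof (rule prox_nonempty[OF \<phi>2_lsc \<phi>2_fin dom(2) \<gamma>_pos])
    fix w
    show "ereal (a + ((1 / \<gamma>) *\<^sub>R (2 *\<^sub>R u0 - s0 - v0)) \<bullet> (w - v0) - 0 / 2 * (norm (w - v0))^2) \<le> \<phi>2 w"
    proof (cases "\<phi>2 w")
      case (real b)
      then show ?thesis using prox2_subgradient[OF start_prox(2) a, of w b] by simp
    qed (use \<phi>2_fin in auto)
  qed simp
qed

sublocale lipschitz_prox_dr \<phi>1 \<phi>2 \<gamma> 1
  by standard (use prox1_nonempty prox2_nonempty \<phi>1_fin \<phi>2_fin prox1_nonexpansive in auto)

text \<open>
  The sum of the subgradient inequalities at \<open>u\<close> and \<open>v\<close>, tested at \<open>x\<close>, exceeds the envelope by a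
  square and by the part of the strong convexity that \<open>\<gamma> \<mu> > 1\<close> leaves over. Besides bounding the
  envelope by \<open>\<phi> x\<close>, it gives \<open>\<phi>\<close> quadratic growth and thus a minimizer.
\<close>

lemma E_le_objective:
  assumes uv: "(u, v) \<in> DRS \<phi>1 \<phi>2 \<gamma> s" and x: "\<phi>1 x \<le> ereal a'" "\<phi>2 x \<le> ereal b'"
  shows "E s + (\<gamma> * \<mu> - 1) / \<gamma> / 2 * (norm (x - u))^2 \<le> a' + b'"
proof -
  obtain a b where ab: "\<phi>1 u = ereal a" "\<phi>2 v = ereal b" using DRS_finite[OF uv] .
  define p A w where "p = s - u" and "A = x - u" and "w = v - u"
  have e: "2 *\<^sub>R u - s - v = - p - w" "x - v = A - w"
    by (simp_all add: p_def A_def w_def scaleR_2 algebra_simps)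
  have "a + 1 / \<gamma> * (p \<bullet> A) + \<mu> / 2 * (norm A)^2 \<le> a'"
    using prox1_subgradient[OF DRS_D(1)[OF uv] ab(1) x(1)] by (simp add: p_def A_def)
  moreover have "b + 1 / \<gamma> * ((- p - w) \<bullet> (A - w)) \<le> b'"
    using prox2_subgradient[OF DRS_D(2)[OF uv] ab(2) x(2)] unfolding e .
  moreover have "E s = a + b + (1 / \<gamma> * (p \<bullet> w) + 1 / (2 * \<gamma>) * (norm w)^2)"
    using E_eq[OF uv ab] by (simp add: dr_coupling_def p_def w_def)
  moreover have "1 / \<gamma> * (p \<bullet> A) + 1 / \<gamma> * ((- p - w) \<bullet> (A - w))
      - (1 / \<gamma> * (p \<bullet> w) + 1 / (2 * \<gamma>) * (norm w)^2) + 1 / (2 * \<gamma>) * (norm A)^2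
      = 1 / (2 * \<gamma>) * (norm (w - A))^2"
    unfolding power2_norm_eq_inner
    by (simp add: inner_diff_left inner_diff_right inner_commute algebra_simps
        add_divide_distrib diff_divide_distrib)
  moreover have "0 \<le> 1 / (2 * \<gamma>) * (norm (w - A))^2" using \<gamma>_pos by simp
  moreover have "(\<gamma> * \<mu> - 1) / \<gamma> / 2 * (norm A)^2
      = \<mu> / 2 * (norm A)^2 - 1 / (2 * \<gamma>) * (norm A)^2"
    using \<gamma>_pos by (simp add: field_simps)
  ultimately show ?thesis unfolding A_def[symmetric] by linarith
qed

lemma E_le_sum: "ereal (E s) \<le> \<phi>1 x + \<phi>2 x"
proof -
  obtain u v where uv: "(u, v) \<in> DRS \<phi>1 \<phi>2 \<gamma> s" using DRS_cases .
  show ?thesis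
  proof (cases "\<phi>1 x"; cases "\<phi>2 x")
    fix a b assume "\<phi>1 x = ereal a" "\<phi>2 x = ereal b"
    moreover have "0 \<le> (\<gamma> * \<mu> - 1) / \<gamma> / 2 * (norm (x - u))^2" using \<gamma>\<mu>_gt_1 \<gamma>_pos by simp
    ultimately show ?thesis using E_le_objective[OF uv, of x a b] by simp
  qed (use \<phi>1_fin[of x] \<phi>2_fin[of x] in auto)
qed

lemma argmin_nonempty: "argmin (\<lambda>x. \<phi>1 x + \<phi>2 x) \<noteq> {}"
proof (rule lsc_quadratic_growth_attains_min)
  show "lsc (\<lambda>x. \<phi>1 x + \<phi>2 x)" by (rule lsc_add[OF \<phi>1_lsc \<phi>2_lsc \<phi>1_fin \<phi>2_fin])
  show "\<phi>1 x0 + \<phi>2 x0 < \<infinity>" using dom by (cases "\<phi>1 x0"; cases "\<phi>2 x0") auto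
  show "0 < (\<gamma> * \<mu> - 1) / \<gamma>" using \<gamma>\<mu>_gt_1 \<gamma>_pos by simp
  fix x
  show "ereal (E s0 + 0 \<bullet> (x - u0) + (\<gamma> * \<mu> - 1) / \<gamma> / 2 * (norm (x - u0))^2) \<le> \<phi>1 x + \<phi>2 x"
  proof (cases "\<phi>1 x"; cases "\<phi>2 x")
    fix a b assume "\<phi>1 x = ereal a" "\<phi>2 x = ereal b"
    then show ?thesis using E_le_objective[OF start, of x a b] by simp
  qed (use \<phi>1_fin[of x] \<phi>2_fin[of x] in auto)
qed

lemma E_quadratic_model:
  assumes uv: "(u, v) \<in> DRS \<phi>1 \<phi>2 \<gamma> s"
  defines "d s' \<equiv> u_of s' - u_of s" and "h s' \<equiv> s' - s - (u_of s' - u_of s)"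
  shows "- E s' \<le> - E s + 1 / \<gamma> * (- (\<gamma> * \<mu> / 2) * (norm (d s'))^2 + 1 / 2 * (norm (h s'))^2
      + (- 1) * ((v - u) \<bullet> (h s' - d s')))"
proof -
  have u: "u_of s = u" using DRS_D(3)[OF uv] by simp
  obtain u' v' where uv': "(u', v') \<in> DRS \<phi>1 \<phi>2 \<gamma> s'" using DRS_cases .
  have u': "u_of s' = u'" using DRS_D(3)[OF uv'] by simp
  obtain a b where ab: "\<phi>1 u = ereal a" "\<phi>2 v = ereal b" using DRS_finite[OF uv] .
  obtain a' b' where ab': "\<phi>1 u' = ereal a'" "\<phi>2 v' = ereal b'" using DRS_finite[OF uv'] .
  let ?m = "(norm (v' - u' - (v - u - h s')))^2 / 2"
  have "a + 1 / \<gamma> * ((s - u) \<bullet> d s') + \<mu> / 2 * (norm (d s'))^2 \<le> a'"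
    using prox1_subgradient[OF DRS_D(1)[OF uv] ab(1), of u' a'] ab' by (simp add: d_def u u')
  moreover have "b + 1 / \<gamma> * ((2 *\<^sub>R u - s - v) \<bullet> (v' - v)) \<le> b'"
    using prox2_subgradient[OF DRS_D(2)[OF uv] ab(2), of v' b'] ab' by simp
  moreover have "E s = a + b + dr_coupling \<gamma> s u v" "E s' = a' + b' + dr_coupling \<gamma> s' u' v'"
    using E_eq[OF uv ab] E_eq[OF uv' ab'] .
  moreover have "dr_coupling \<gamma> s' u' v' - dr_coupling \<gamma> s u v
      + 1 / \<gamma> * ((s - u) \<bullet> d s') + 1 / \<gamma> * ((2 *\<^sub>R u - s - v) \<bullet> (v' - v))
      = 1 / \<gamma> * (?m - (norm (h s'))^2 / 2 + (v - u) \<bullet> (h s' - d s'))"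
    using dr_coupling_change_strongly_convex[of \<gamma> s' u' v' s u v]
    by (simp add: d_def h_def u u')
  moreover have "1 / \<gamma> * (?m - (norm (h s'))^2 / 2 + (v - u) \<bullet> (h s' - d s'))
      = 1 / \<gamma> * ?m - 1 / \<gamma> * ((norm (h s'))^2 / 2 - (v - u) \<bullet> (h s' - d s'))"
    by (simp add: algebra_simps)
  moreover have "0 \<le> 1 / \<gamma> * ?m" using \<gamma>_pos by simp
  moreover have "1 / \<gamma> * (- (\<gamma> * \<mu> / 2) * (norm (d s'))^2 + 1 / 2 * (norm (h s'))^2
      + (- 1) * ((v - u) \<bullet> (h s' - d s')))
    = 1 / \<gamma> * ((norm (h s'))^2 / 2 - (v - u) \<bullet> (h s' - d s')) - \<mu> / 2 * (norm (d s'))^2"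
    using \<gamma>_pos by (simp add: field_simps)
  ultimately show ?thesis by linarith
qed

lemma decrease_near_nominal:
  assumes lam: "0 < lam" "lam < 2"
    and c: "0 < c" "c < dr_const \<phi>1 (1 / (\<gamma> * \<mu>)) lam"
    and uv: "(u, v) \<in> DRS \<phi>1 \<phi>2 \<gamma> s" "u \<noteq> v"
  shows "\<forall>\<^sub>F s' in nhds (nominal_point lam s u v). - E s' \<le> - E s - c / \<gamma> * (norm (u - v))^2"
proof -
  define \<alpha> where "\<alpha> = 1 / (\<gamma> * \<mu>)"
  define z where "z = nominal_point lam s u v"
  have \<alpha>: "0 \<le> \<alpha>" using \<gamma>\<mu>_gt_1 by (simp add: \<alpha>_def)
  have u: "u = u_of s" using DRS_D(3)[OF uv(1)] .
  have hd: "norm (u_of z - u_of s) \<le> \<alpha> * norm (z - s - (u_of z - u_of s))"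
    unfolding \<alpha>_def using prox1_contraction u_of by blast
  have rel: "lam *\<^sub>R (v - u) = (z - s - (u_of z - u_of s)) + (u_of z - u_of s)"
    by (simp add: z_def nominal_point_def algebra_simps)
  have conv: "econvex \<phi>1" using strongly_econvex_imp_econvex[OF \<phi>1_sc \<phi>1_fin] .
  have Cpos: "0 < dr_const \<phi>1 \<alpha> lam" using c unfolding \<alpha>_def by simp
  have \<kappa>: "0 \<le> (2 - lam) / 2 - \<alpha> * max (\<alpha> - lam / 2) 0"
    using Cpos lam conv \<alpha> by (auto simp: dr_const_def zero_less_mult_iff zero_less_divide_iff)
  have half: "x / (2 * \<alpha>) = \<gamma> * \<mu> / 2 * x" for x by (simp add: \<alpha>_def)
  have nominal: "- (\<gamma> * \<mu> / 2) * (norm (u_of z - u_of s))^2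
      + 1 / 2 * (norm (z - s - (u_of z - u_of s)))^2
      + (- 1) * ((v - u) \<bullet> (z - s - (u_of z - u_of s) - (u_of z - u_of s)))
    \<le> - dr_const \<phi>1 \<alpha> lam * (norm (v - u))^2"
    using decrease_bound_convex[OF rel lam(1) \<alpha> hd \<kappa>] conv unfolding half
    by (simp add: dr_const_def inner_diff_right)
  have "\<forall>\<^sub>F s' in nhds z. - E s' \<le> - E s - c / \<gamma> * (norm (v - u))^2"
    by (rule eventually_decrease_of_quadratic_model[OF u_of_lipschitz E_quadratic_model[OF uv(1)] nominal
          c(2)[folded \<alpha>_def] _ \<gamma>_pos]) (use uv(2) in simp)
  then show ?thesis by (simp add: z_def norm_minus_commute)
qed

lemma prox_inclusions:
  assumes uv: "(u, v) \<in> DRS \<phi>1 \<phi>2 \<gamma> s"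
  shows "(1 / \<gamma>) *\<^sub>R (s - u) \<in> convex_subdiff \<phi>1 u"
    and "(1 / \<gamma>) *\<^sub>R (2 *\<^sub>R u - s - v) \<in> convex_subdiff \<phi>2 v"
proof -
  obtain a b where ab: "\<phi>1 u = ereal a" "\<phi>2 v = ereal b" using DRS_finite[OF uv] .
  have "\<phi>1 u + ereal (((1 / \<gamma>) *\<^sub>R (s - u)) \<bullet> (y - u)) \<le> \<phi>1 y" for y
  proof (cases "\<phi>1 y")
    case (real a')
    have "0 \<le> \<mu> / 2 * (norm (y - u))^2" using \<mu>_pos by simp
    then show ?thesis
      using prox1_subgradient[OF DRS_D(1)[OF uv] ab(1), of y a'] real ab by simp
  qed (use \<phi>1_fin in auto)
  then show "(1 / \<gamma>) *\<^sub>R (s - u) \<in> convex_subdiff \<phi>1 u" by (simp add: convex_subdiff_def ab)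
  have "\<phi>2 v + ereal (((1 / \<gamma>) *\<^sub>R (2 *\<^sub>R u - s - v)) \<bullet> (y - v)) \<le> \<phi>2 y" for y
  proof (cases "\<phi>2 y")
    case (real b')
    then show ?thesis
      using prox2_subgradient[OF DRS_D(2)[OF uv] ab(2), of y b'] ab by simp
  qed (use \<phi>2_fin in auto)
  then show "(1 / \<gamma>) *\<^sub>R (2 *\<^sub>R u - s - v) \<in> convex_subdiff \<phi>2 v"
    by (simp add: convex_subdiff_def ab)
qed

end

section \<open>Termination of the linesearch\<close>

text \<open>
  The properties of a signed envelope \<open>\<pi> E\<close> under which the linesearch terminates. Both cases have
  them, with \<open>\<pi> = 1\<close> and \<open>\<pi> = -1\<close> respectively.
\<close>

locale dr_linesearch =
  fixes \<phi>1 \<phi>2 :: "'a::real_inner \<Rightarrow> ereal" and \<pi> \<gamma> lam c \<epsilon> :: real and imax :: enat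
    and E :: "'a \<Rightarrow> real" and m :: real
  assumes \<gamma>_pos: "0 < \<gamma>" and c_pos: "0 < c" and \<epsilon>_pos: "0 < \<epsilon>"
    and DRS_nonempty: "DRS \<phi>1 \<phi>2 \<gamma> s \<noteq> {}"
    and DRE_eq: "DRE \<phi>1 \<phi>2 \<gamma> s = ereal (E s)"
    and bounded_below: "m \<le> \<pi> * E s"
    and decrease_near_nominal: "(u, v) \<in> DRS \<phi>1 \<phi>2 \<gamma> s \<Longrightarrow> u \<noteq> v \<Longrightarrow>
      \<forall>\<^sub>F s' in nhds (nominal_point lam s u v). \<pi> * E s' \<le> \<pi> * E s - c / \<gamma> * (norm (u - v))^2"
begin

abbreviation step :: "'a config \<Rightarrow> 'a config \<Rightarrow> bool" where
  "step \<equiv> dr_step \<phi>1 \<phi>2 \<pi> \<gamma> lam c \<epsilon> imax"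

lemma sufficient_decrease_iff:
  "sufficient_decrease \<phi>1 \<phi>2 \<pi> \<gamma> c s u v s' \<longleftrightarrow> \<pi> * E s' \<le> \<pi> * E s - c / \<gamma> * (norm (u - v))^2"
  by (simp add: sufficient_decrease_def DRE_eq)

lemma sufficient_decrease_nominal:
  assumes "(u, v) \<in> DRS \<phi>1 \<phi>2 \<gamma> s" "u \<noteq> v"
  shows "sufficient_decrease \<phi>1 \<phi>2 \<pi> \<gamma> c s u v (nominal_point lam s u v)"
  using eventually_nhds_x_imp_x[OF decrease_near_nominal[OF assms]]
  by (simp add: sufficient_decrease_iff)

lemma sufficient_decrease_small_step:
  assumes "(u, v) \<in> DRS \<phi>1 \<phi>2 \<gamma> s" "u \<noteq> v"
  obtains B where "\<And>i. B \<le> i \<Longrightarrow>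
    sufficient_decrease \<phi>1 \<phi>2 \<pi> \<gamma> c s u v (trial_point lam s u v d ((1 / 2) ^ i))"
proof -
  have "(\<lambda>i. trial_point lam s u v d ((1 / 2) ^ i)) \<longlonglongrightarrow>
      (1 - 0) *\<^sub>R nominal_point lam s u v + 0 *\<^sub>R (s + d)"
    unfolding trial_point_def by (intro tendsto_intros LIMSEQ_power_zero) auto
  then have "filterlim (\<lambda>i. trial_point lam s u v d ((1 / 2) ^ i))
      (nhds (nominal_point lam s u v)) sequentially" by simp
  then have "\<forall>\<^sub>F i in sequentially.
      sufficient_decrease \<phi>1 \<phi>2 \<pi> \<gamma> c s u v (trial_point lam s u v d ((1 / 2) ^ i))"
    unfolding sufficient_decrease_iff
    by (rule eventually_compose_filterlim[OF decrease_near_nominal[OF assms]])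
  then show ?thesis using that by (auto simp: eventually_sequentially)
qed

fun invariant :: "'a \<Rightarrow> 'a config \<Rightarrow> bool" where
  "invariant s0 (Outer k s u v) \<longleftrightarrow>
     (u, v) \<in> DRS \<phi>1 \<phi>2 \<gamma> s \<and> \<pi> * E s + real k * (c * \<gamma> * \<epsilon>^2) \<le> \<pi> * E s0"
| "invariant s0 (Trial k s u v d \<tau> i) \<longleftrightarrow>
     (u, v) \<in> DRS \<phi>1 \<phi>2 \<gamma> s \<and> \<pi> * E s + real k * (c * \<gamma> * \<epsilon>^2) \<le> \<pi> * E s0
     \<and> \<gamma> * \<epsilon> < norm (u - v) \<and> \<tau> = (1 / 2) ^ i"
| "invariant s0 (Returned k s u v) \<longleftrightarrow>
     (u, v) \<in> DRS \<phi>1 \<phi>2 \<gamma> s \<and> \<pi> * E s + real k * (c * \<gamma> * \<epsilon>^2) \<le> \<pi> * E s0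
     \<and> norm (u - v) \<le> \<gamma> * \<epsilon>"

lemma stopping_test_iff: "1 / \<gamma> * norm (u - v) \<le> \<epsilon> \<longleftrightarrow> norm (u - v) \<le> \<gamma> * \<epsilon>" for u v :: 'a
  using \<gamma>_pos by (simp add: field_simps)

lemma decrease_per_iteration:
  assumes "sufficient_decrease \<phi>1 \<phi>2 \<pi> \<gamma> c s u v s'" "\<gamma> * \<epsilon> < norm (u - v)"
    and "\<pi> * E s + real k * (c * \<gamma> * \<epsilon>^2) \<le> \<pi> * E s0"
  shows "\<pi> * E s' + real (Suc k) * (c * \<gamma> * \<epsilon>^2) \<le> \<pi> * E s0"
proof -
  have "(\<gamma> * \<epsilon>)^2 \<le> (norm (u - v))^2" using assms(2) \<gamma>_pos \<epsilon>_pos by (intro power_mono) auto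
  then have "c / \<gamma> * (\<gamma> * \<epsilon>)^2 \<le> c / \<gamma> * (norm (u - v))^2"
    using \<gamma>_pos c_pos by (intro mult_left_mono) auto
  moreover have "c / \<gamma> * (\<gamma> * \<epsilon>)^2 = c * \<gamma> * \<epsilon>^2"
    using \<gamma>_pos by (simp add: power2_eq_square)
  ultimately show ?thesis
    using assms(1,3) by (simp add: sufficient_decrease_iff algebra_simps)
qed

lemma residual_nonzero: "\<gamma> * \<epsilon> < norm (u - v) \<Longrightarrow> u \<noteq> v" for u v :: 'a
  using mult_pos_pos[OF \<gamma>_pos \<epsilon>_pos] by auto

lemma invariant_step:
  assumes "step x y" "invariant s0 x"
  shows "invariant s0 y"
  using assms
proof cases
  case (accept s' s u v d \<tau> u' v' k i)
  then show ?thesis using assms(2) decrease_per_iteration[of s u v s' k s0] by simp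
next
  case (nominal s' s u v d \<tau> u' v' i s'' u'' v'' k)
  then show ?thesis
    using assms(2) decrease_per_iteration[of s u v s'' k s0] sufficient_decrease_nominal[of u v s]
      residual_nonzero[of u v] by simp
next
  case (stop u v k s)
  then show ?thesis using assms(2) stopping_test_iff[of u v] by simp
next
  case (direction u v k s d)
  have "\<gamma> * \<epsilon> < norm (u - v)"
    using direction(3) stopping_test_iff[of u v] by (metis not_le)
  then show ?thesis using assms(2) direction by simp
qed (use assms(2) in auto)

text \<open>
  The oracle never fails, so an execution can only end by returning.
\<close>

lemma progress:
  assumes "\<nexists>y. step x y"
  shows "\<exists>k s u v. x = Returned k s u v"
proof (cases x)
  case (Outer k s u v)
  have "\<exists>y. step x y"
    unfolding Outer by (cases "1 / \<gamma> * norm (u - v) \<le> \<epsilon>") (blast intro: dr_step.stop dr_step.direction)+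
  then show ?thesis using assms by blast
next
  case (Trial k s u v d \<tau> i)
  obtain u' v' where uv': "(u', v') \<in> DRS \<phi>1 \<phi>2 \<gamma> (trial_point lam s u v d \<tau>)"
    using DRS_nonempty by fast
  obtain u'' v'' where uv'': "(u'', v'') \<in> DRS \<phi>1 \<phi>2 \<gamma> (nominal_point lam s u v)"
    using DRS_nonempty by fast
  have "\<exists>y. step x y"
    unfolding Trial
    by (cases "sufficient_decrease \<phi>1 \<phi>2 \<pi> \<gamma> c s u v (trial_point lam s u v d \<tau>)";
        cases "enat i = imax")
      (blast intro: dr_step.accept[OF refl uv'] dr_step.backtrack[OF refl uv']
         dr_step.nominal[OF refl uv' _ _ refl uv''])+
  then show ?thesis using assms by blast
qed auto

text \<open>
  From some number \<open>B\<close> of backtrackings on every trial point is accepted, so the induction is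
  on \<open>B - i\<close>.
\<close>

lemma infinite_run_leaves_trial:
  assumes run: "\<And>n. step (\<sigma> n) (\<sigma> (Suc n))" and inv: "\<And>n. invariant s0 (\<sigma> n)"
    and "\<sigma> n = Trial k s u v d \<tau> i"
  shows "\<exists>n' s' u' v'. \<sigma> n' = Outer (Suc k) s' u' v'"
proof -
  have "(u, v) \<in> DRS \<phi>1 \<phi>2 \<gamma> s" "u \<noteq> v"
    using inv[of n] assms(3) residual_nonzero by auto
  then obtain B where B: "\<And>i. B \<le> i \<Longrightarrow>
      sufficient_decrease \<phi>1 \<phi>2 \<pi> \<gamma> c s u v (trial_point lam s u v d ((1 / 2) ^ i))"
    using sufficient_decrease_small_step by blast
  show ?thesis using assms(3)
  proof (induction "B - i" arbitrary: n \<tau> i rule: less_induct)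
    case less
    have \<tau>: "\<tau> = (1 / 2) ^ i" using inv[of n] less.prems by simp
    from run[of n] show ?case unfolding less.prems
    proof cases
      case (backtrack s' u' v')
      then have "i < B" using B[of i] \<tau> by (metis not_le)
      then show ?thesis using less.hyps[of "Suc i" "Suc n" "\<tau> / 2"] backtrack by simp
    qed blast+
  qed
qed

text \<open>
  In an infinite run every iteration would be left, so the iteration counter would exceed the bound
  that the decrease by \<open>c \<gamma> \<epsilon>\<^sup>2\<close> per iteration imposes.
\<close>

lemma execution_terminates:
  assumes "execution \<phi>1 \<phi>2 \<pi> \<gamma> lam c \<epsilon> imax s0 \<sigma> N"
  obtains M k s u v where "N = enat M" "\<sigma> M = Returned k s u v" "(u, v) \<in> DRS \<phi>1 \<phi>2 \<gamma> s"
    "norm (u - v) \<le> \<gamma> * \<epsilon>" "real k * (c * \<gamma> * \<epsilon>^2) \<le> \<pi> * E s0 - m"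
proof -
  obtain u0 v0 where start: "(u0, v0) \<in> DRS \<phi>1 \<phi>2 \<gamma> s0" "\<sigma> 0 = Outer 0 s0 u0 v0"
    and run: "\<And>n. enat n < N \<Longrightarrow> step (\<sigma> n) (\<sigma> (Suc n))"
    and stuck: "\<And>M. N = enat M \<Longrightarrow> \<nexists>x. step (\<sigma> M) x"
    using assms unfolding execution_def by blast
  have inv: "invariant s0 (\<sigma> n)" if "enat n \<le> N" for n
    using that
  proof (induction n)
    case (Suc n)
    then have "enat n < N" by (metis Suc_ile_eq)
    then show ?case using invariant_step[OF run] Suc.IH by simp
  qed (use start in simp)
  have count: "real k * (c * \<gamma> * \<epsilon>^2) \<le> \<pi> * E s0 - m"
    if "\<pi> * E s + real k * (c * \<gamma> * \<epsilon>^2) \<le> \<pi> * E s0" for k s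
    using that bounded_below[of s] by simp
  have "N \<noteq> \<infinity>"
  proof
    assume N: "N = \<infinity>"
    then have run: "\<And>n. step (\<sigma> n) (\<sigma> (Suc n))" and inv: "\<And>n. invariant s0 (\<sigma> n)"
      using run inv by auto
    have Outer: "\<exists>n s u v. \<sigma> n = Outer k s u v" for k
    proof (induction k)
      case 0
      then show ?case using start by blast
    next
      case (Suc k)
      then obtain n s u v where n: "\<sigma> n = Outer k s u v" by blast
      from run[of n] show ?case unfolding n
      proof cases
        case stop
        have False using run[of "Suc n"] stop by (auto elim: dr_step.cases)
        then show ?thesis ..
      next
        case (direction d)
        then show ?thesis using infinite_run_leaves_trial[of \<sigma> s0, OF run inv] by blast
      qed
    qed
    have pos: "0 < c * \<gamma> * \<epsilon>^2" using c_pos \<gamma>_pos \<epsilon>_pos by simp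
    then obtain k where k: "\<pi> * E s0 - m < real k * (c * \<gamma> * \<epsilon>^2)"
      using reals_Archimedean3 by blast
    obtain n s u v where "\<sigma> n = Outer k s u v" using Outer by blast
    then show False using inv[of n] count[of s k] k by simp
  qed
  then obtain M where M: "N = enat M" by auto
  obtain k s u v where R: "\<sigma> M = Returned k s u v" using progress stuck[OF M] by blast
  then show ?thesis using that[OF M R] inv[of M] M count[of s k] by simp
qed

end

section \<open>The convergence theorem\<close>

theorem theorem4p1:
  fixes \<phi>1 \<phi>2 :: "real ^ 'p \<Rightarrow> ereal"
    and s0 :: "real ^ 'p"
    and mode :: dr_case
    and \<gamma> lam c \<epsilon> :: real
    and imax N :: enat
    and \<sigma> :: "nat \<Rightarrow> (real ^ 'p) config"
  assumes "\<forall>x. \<phi>1 x \<noteq> -\<infinity>" and "\<forall>x. \<phi>2 x \<noteq> -\<infinity>"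
    and "dr_assumption mode \<phi>1 \<phi>2"
    and "0 < \<epsilon>" and "0 < lam" and "lam < 2"
    and "dr_params mode \<phi>1 \<gamma> lam c"
    and "execution \<phi>1 \<phi>2 (dr_sign mode) \<gamma> lam c \<epsilon> imax s0 \<sigma> N"
  shows "(\<forall>k. finite (backtracks \<sigma> N k))
    \<and> (\<exists>M K sK uK vK. N = enat M \<and> \<sigma> M = Returned K sK uK vK
        \<and> (\<exists>x\<in>argmin (\<lambda>x. \<phi>1 x + \<phi>2 x).
             ereal (real K) \<le> ereal (1 / (c * \<gamma> * \<epsilon>\<^sup>2)) * \<bar>DRE \<phi>1 \<phi>2 \<gamma> s0 - (\<phi>1 x + \<phi>2 x)\<bar>)
        \<and> (case mode of
             Smooth L \<Rightarrow> edist_set 0 (regular_subdiff (\<lambda>x. \<phi>1 x + \<phi>2 x) vK) \<le> ereal (2 * \<epsilon>)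
           | Strongly_Convex \<mu> \<Rightarrow>
               (let x = uK; y = (1 / \<gamma>) *\<^sub>R (uK - sK); z = vK in
                  - y \<in> convex_subdiff \<phi>1 x
                  \<and> edist_set y (convex_subdiff \<phi>2 z) \<le> ereal \<epsilon>
                  \<and> norm (x - z) \<le> \<gamma> * \<epsilon>)))"
proof -
  have backtracks: "finite (backtracks \<sigma> N k)" if "N = enat M" for M k
    by (rule finite_subset[of _ "{..<M}"]) (auto simp: backtracks_def that)
  have count: "ereal (real k) \<le> ereal (1 / (c * \<gamma> * \<epsilon>\<^sup>2)) * \<bar>ereal e - ereal m\<bar>"
    if "real k * (c * \<gamma> * \<epsilon>\<^sup>2) \<le> \<bar>e - m\<bar>" "0 < c" "0 < \<gamma>" for k e m
  proof -
    have "0 < c * \<gamma> * \<epsilon>\<^sup>2" using that assms(4) by simp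
    then show ?thesis using that(1) by (simp add: field_simps)
  qed
  show ?thesis
  proof (cases mode)
    case (Smooth L)
    from assms(3)[unfolded Smooth] obtain f G x where f: "\<phi>1 = (\<lambda>x. ereal (f x))"
      and G: "\<And>x. GDERIV f x :> G x" and lip: "L-lipschitz_on UNIV G"
      and lsc: "lsc \<phi>2" and x: "x \<in> argmin (\<lambda>x. \<phi>1 x + \<phi>2 x)"
      by (auto simp: smooth_assumption_def)
    from assms(7)[unfolded Smooth] have \<gamma>: "0 < \<gamma>" and c: "0 < c" "c < dr_const \<phi>1 (\<gamma> * L) lam"
      and stepsize: "if econvex \<phi>1 then \<gamma> * L < 1 else \<gamma> * (2 * L) < 2 - lam" by auto
    (* without convexity the stepsize satisfies the stronger bound (2 - lam) / 2 < 1 *)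
    have \<gamma>L: "\<gamma> * L < 1" using stepsize assms(5) by (auto split: if_splits)
    obtain b where b: "\<phi>2 x = ereal b"
      using x assms(2) by (cases "\<phi>2 x") (auto simp: argmin_def f)
    interpret smooth_dr f G L \<gamma> \<phi>2 x "f x + b"
    proof
      fix y b' assume "\<phi>2 y \<le> ereal b'"
      have "ereal (f x + b) \<le> ereal (f y) + \<phi>2 y" using x by (simp add: argmin_def f b)
      also have "\<dots> \<le> ereal (f y) + ereal b'" using \<open>\<phi>2 y \<le> ereal b'\<close> by (rule add_left_mono)
      finally show "f x + b \<le> f y + b'" by simp
    qed (use G lip assms(2) lsc \<gamma> \<gamma>L b in auto)
    interpret dr_linesearch \<phi>1 \<phi>2 1 \<gamma> lam c \<epsilon> imax E "f x + b"
      unfolding f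
      by standard (use \<gamma> c assms(4) DRS_nonempty DRE_eq_E min_le_E
          decrease_near_nominal[OF assms(5,6) c[unfolded f]] in auto)
    obtain M k s u v where M: "N = enat M" "\<sigma> M = Returned k s u v"
      and uv: "(u, v) \<in> DRS \<phi>1 \<phi>2 \<gamma> s" "norm (u - v) \<le> \<gamma> * \<epsilon>"
      and k: "real k * (c * \<gamma> * \<epsilon>^2) \<le> 1 * E s0 - (f x + b)"
      using execution_terminates assms(8)[unfolded Smooth dr_sign.simps] .
    have "ereal (real k) \<le> ereal (1 / (c * \<gamma> * \<epsilon>\<^sup>2)) * \<bar>DRE \<phi>1 \<phi>2 \<gamma> s0 - (\<phi>1 x + \<phi>2 x)\<bar>"
      using count[of k "E s0" "f x + b"] k c \<gamma> by (simp add: f b DRE_eq_E)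
    moreover have "edist_set 0 (regular_subdiff (\<lambda>x. \<phi>1 x + \<phi>2 x) v) \<le> ereal (2 * \<epsilon>)"
    proof -
      let ?q = "G v + (1 / \<gamma>) *\<^sub>R (2 *\<^sub>R u - s - v)"
      have q: "?q \<in> regular_subdiff (\<lambda>x. \<phi>1 x + \<phi>2 x) v" "norm ?q \<le> 2 / \<gamma> * norm (u - v)"
        using residual_subgradient[OF uv(1)[unfolded f]] unfolding f .
      have "norm ?q \<le> 2 / \<gamma> * (\<gamma> * \<epsilon>)"
        using q(2) mult_left_mono[OF uv(2), of "2 / \<gamma>"] \<gamma> by simp
      then have "ereal (norm (?q - 0)) \<le> ereal (2 * \<epsilon>)" using \<gamma> by simp
      then show ?thesis unfolding edist_set_def using q(1) by (rule INF_lower2[rotated])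
    qed
    ultimately show ?thesis using M x backtracks by (auto simp: Smooth)
  next
    case (Strongly_Convex \<mu>)
    from assms(3)[unfolded Strongly_Convex] have sc: "lsc \<phi>1" "strongly_econvex \<mu> \<phi>1"
      "lsc \<phi>2" "econvex \<phi>2" and ri: "0 \<in> rel_interior {x - y |x y. x \<in> edom \<phi>1 \<and> y \<in> edom \<phi>2}"
      by (auto simp: strongly_convex_assumption_def)
    obtain x0 where x0: "\<phi>1 x0 < \<infinity>" "\<phi>2 x0 < \<infinity>"
      using rel_interior_subset[THEN subsetD, OF ri] by (auto simp: edom_def)
    from assms(7)[unfolded Strongly_Convex] have \<gamma>: "1 / \<mu> < \<gamma>"
      and c: "0 < c" "c < dr_const \<phi>1 (1 / (\<gamma> * \<mu>)) lam" by auto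
    obtain u0 v0 where start: "(u0, v0) \<in> DRS \<phi>1 \<phi>2 \<gamma> s0"
      using assms(8) unfolding execution_def by blast
    interpret strongly_convex_dr \<phi>1 \<phi>2 \<mu> \<gamma> x0 s0 u0 v0
      by standard (use assms(1,2) sc x0 \<gamma> start in auto)
    obtain x where x: "x \<in> argmin (\<lambda>x. \<phi>1 x + \<phi>2 x)" using argmin_nonempty by blast
    obtain m where m: "\<phi>1 x + \<phi>2 x = ereal m"
      using x E_le_sum[of s0 x] by (cases "\<phi>1 x + \<phi>2 x") (auto simp: argmin_def)
    interpret dr_linesearch \<phi>1 \<phi>2 "-1" \<gamma> lam c \<epsilon> imax E "- m"
    proof
      show "- m \<le> - 1 * E s" for s using E_le_sum[of s x] by (simp add: m)
    qed (use \<gamma>_pos c assms(4) DRS_nonempty DRE_eq_E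
        decrease_near_nominal[OF assms(5,6) c] in auto)
    obtain M k s u v where M: "N = enat M" "\<sigma> M = Returned k s u v"
      and uv: "(u, v) \<in> DRS \<phi>1 \<phi>2 \<gamma> s" "norm (u - v) \<le> \<gamma> * \<epsilon>"
      and k: "real k * (c * \<gamma> * \<epsilon>^2) \<le> - 1 * E s0 - - m"
      using execution_terminates assms(8)[unfolded Strongly_Convex dr_sign.simps] .
    have "ereal (real k) \<le> ereal (1 / (c * \<gamma> * \<epsilon>\<^sup>2)) * \<bar>DRE \<phi>1 \<phi>2 \<gamma> s0 - (\<phi>1 x + \<phi>2 x)\<bar>"
      using count[of k "E s0" m] k c \<gamma>_pos by (simp add: m DRE_eq_E)
    moreover have "- ((1 / \<gamma>) *\<^sub>R (u - s)) \<in> convex_subdiff \<phi>1 u"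
      using prox_inclusions(1)[OF uv(1)] by (simp add: scaleR_minus_right[symmetric])
    moreover have "edist_set ((1 / \<gamma>) *\<^sub>R (u - s)) (convex_subdiff \<phi>2 v) \<le> ereal \<epsilon>"
    proof -
      let ?q = "(1 / \<gamma>) *\<^sub>R (2 *\<^sub>R u - s - v)"
      have "?q - (1 / \<gamma>) *\<^sub>R (u - s) = (1 / \<gamma>) *\<^sub>R (u - v)"
        by (simp add: scaleR_2 algebra_simps)
      then have "norm (?q - (1 / \<gamma>) *\<^sub>R (u - s)) = norm (u - v) / \<gamma>" using \<gamma>_pos by simp
      also have "\<dots> \<le> \<epsilon>" using uv(2) \<gamma>_pos by (simp add: pos_divide_le_eq mult.commute)
      finally have "ereal (norm (?q - (1 / \<gamma>) *\<^sub>R (u - s))) \<le> ereal \<epsilon>" by simp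
      then show ?thesis unfolding edist_set_def
        using prox_inclusions(2)[OF uv(1)] by (rule INF_lower2[rotated])
    qed
    ultimately show ?thesis using M x backtracks uv(2) by (auto simp: Strongly_Convex Let_def)
  qed
qed

end
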